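(* For any prime $p\equiv 11 \pmod{12}$, with absolute implied constants: (i) $A_{p+2}\times \mathrm{AGL}(1,p)^{(2)}$ has a presentation with $2$ generators, $3$ relations and bit-length $O(\log p)$; and (ii) $A_{p+2}$ has a presentation with $2$ generators, $4$ relations and bit-length $O(\log p)$.
   Context: $\mathrm{AGL}(1,p)$ is the group of all maps $x\mapsto ax+b$ of $\mathbb{F}_p$ with $a\in\mathbb{F}_p^*$, $b\in\mathbb{F}_p$, and $\mathrm{AGL}(1,p)^{(2)}$ denotes its subgroup of index $2$ (those maps with $a$ a nonzero square). A presentation $\langle X\mid R\rangle$ has $|X|$ generators and $|R|$ relations. Its bit-length is the total number of bits required to write the presentation: all exponents are encoded as binary strings, the sum of whose lengths enters into the bit-length, as does the space required to enumerate the list of generators and relations. The bit-length $bl(w)$ of a word $w$ (words may be written using nested powers) is required to satisfy $bl(x)=1$ for $x\in X$; $bl(w^m)\le bl(w)+\log|m|$ for $m\in\mathbb{Z}\setminus\{0,1,-1\}$; and $bl(ww')\le bl(w)+bl(w')$ for all words $w,w'$. Logarithms are to the base $2$. *)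

theory Defs
  imports
    Complex_Main
    "HOL-Algebra.Sym_Groups"
    "HOL-Algebra.Bij"
    "HOL-Algebra.Generated_Groups"
    "HOL-Algebra.Coset"
    "HOL-Number_Theory.Residues"
begin

section \<open>Free groups\<close>

text \<open>The letter \<open>(x, True)\<close> stands for the generator \<open>x\<close> and \<open>(x, False)\<close> for its inverse;
  elements of the free group are the freely reduced lists of letters.\<close>

type_synonym 'x letter = "'x \<times> bool"

definition letter_inv :: "'x letter \<Rightarrow> 'x letter" where
  "letter_inv l = (fst l, \<not> snd l)"

definition reduced :: "'x letter list \<Rightarrow> bool" where
  "reduced w \<longleftrightarrow> successively (\<lambda>l m. m \<noteq> letter_inv l) w"

fun cons_letter :: "'x letter \<Rightarrow> 'x letter list \<Rightarrow> 'x letter list" where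
  "cons_letter l [] = [l]"
| "cons_letter l (m # w) = (if m = letter_inv l then w else l # m # w)"

definition free_group :: "'x set \<Rightarrow> 'x letter list monoid" where
  "free_group X =
     \<lparr>carrier = {w. reduced w \<and> fst ` set w \<subseteq> X},
      mult = foldr cons_letter,
      one = []\<rparr>"

lemma letter_inv_letter_inv [simp]: "letter_inv (letter_inv l) = l"
  by (simp add: letter_inv_def)

lemma fst_letter_inv [simp]: "fst (letter_inv l) = fst l"
  by (simp add: letter_inv_def)

lemma reduced_cons_letter: "reduced w \<Longrightarrow> reduced (cons_letter l w)"
  by (cases w) (auto simp: reduced_def successively_Cons)

lemma set_cons_letter: "set (cons_letter l w) \<subseteq> insert l (set w)"
  by (cases w) auto

lemma cons_letter_cancel: "reduced w \<Longrightarrow> cons_letter l (cons_letter (letter_inv l) w) = w"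
  by (cases w; cases "tl w") (auto simp: reduced_def successively_Cons)

lemma reduced_foldr: "reduced v \<Longrightarrow> reduced (foldr cons_letter u v)"
  by (induction u) (auto simp: reduced_cons_letter)

lemma set_foldr: "set (foldr cons_letter u v) \<subseteq> set u \<union> set v"
  by (induction u) (use set_cons_letter in fastforce)+

lemma foldr_cons_letter:
  assumes "reduced w"
  shows "foldr cons_letter (cons_letter l v) w = cons_letter l (foldr cons_letter v w)"
proof (cases v)
  case (Cons m v')
  then show ?thesis
    using cons_letter_cancel[OF reduced_foldr[OF assms], of l v'] by auto
qed simp

lemma foldr_assoc:
  assumes "reduced w"
  shows "foldr cons_letter (foldr cons_letter u v) w = foldr cons_letter u (foldr cons_letter v w)"
  by (induction u) (auto simp: foldr_cons_letter[OF assms])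

lemma foldr_Nil: "reduced w \<Longrightarrow> foldr cons_letter w [] = w"
proof (induction w)
  case (Cons l w)
  then show ?case by (cases w) (auto simp: reduced_def)
qed simp

lemma foldr_inverse:
  "reduced v \<Longrightarrow> foldr cons_letter (rev (map letter_inv u)) (foldr cons_letter u v) = v"
proof (induction u arbitrary: v)
  case (Cons l u)
  have "cons_letter (letter_inv l) (cons_letter l (foldr cons_letter u v)) = foldr cons_letter u v"
    using cons_letter_cancel[OF reduced_foldr[OF Cons.prems], of "letter_inv l"] by simp
  with Cons show ?case by simp
qed simp

lemma group_free_group: "group (free_group X)"
proof (rule groupI)
  fix u v assume "u \<in> carrier (free_group X)" "v \<in> carrier (free_group X)"
  then show "u \<otimes>\<^bsub>free_group X\<^esub> v \<in> carrier (free_group X)"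
    using set_foldr[of u v] by (fastforce simp: free_group_def reduced_foldr)
next
  fix u assume u: "u \<in> carrier (free_group X)"
  define v where "v = foldr cons_letter (rev (map letter_inv u)) []"
  have v: "v \<in> carrier (free_group X)"
  proof -
    have "fst ` set v \<subseteq> fst ` letter_inv ` set u"
      using image_mono[OF set_foldr[of "rev (map letter_inv u)" "[]"], of fst] by (simp add: v_def)
    also have "fst ` letter_inv ` set u \<subseteq> X"
      using u by (simp add: free_group_def image_image)
    finally have "fst ` set v \<subseteq> X" .
    moreover have "reduced v"
      unfolding v_def by (rule reduced_foldr) (simp add: reduced_def)
    ultimately show ?thesis by (simp add: free_group_def)
  qed
  have "v \<otimes>\<^bsub>free_group X\<^esub> u = foldr cons_letter (rev (map letter_inv u)) (foldr cons_letter u [])"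
    using u by (simp add: v_def free_group_def foldr_assoc foldr_Nil)
  also have "\<dots> = \<one>\<^bsub>free_group X\<^esub>"
    by (subst foldr_inverse) (auto simp: free_group_def reduced_def)
  finally show "\<exists>y\<in>carrier (free_group X). y \<otimes>\<^bsub>free_group X\<^esub> u = \<one>\<^bsub>free_group X\<^esub>"
    using v by blast
qed (auto simp: free_group_def reduced_def foldr_assoc)


section \<open>Words with nested powers and their bit-length\<close>

text \<open>Inverses are written as powers with exponent \<open>-1\<close>.\<close>

datatype 'x pword =
    Gen 'x
  | Mul "'x pword" "'x pword"
  | Pow "'x pword" int

primrec pword_val :: "('a, 'b) monoid_scheme \<Rightarrow> ('x \<Rightarrow> 'a) \<Rightarrow> 'x pword \<Rightarrow> 'a" where
  "pword_val G f (Gen x) = f x"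
| "pword_val G f (Mul u v) = pword_val G f u \<otimes>\<^bsub>G\<^esub> pword_val G f v"
| "pword_val G f (Pow w m) = pword_val G f w [^]\<^bsub>G\<^esub> m"

text \<open>The rules \<open>bl(x) = 1\<close>, \<open>bl(w\<^sup>m) \<le> bl(w) + log |m|\<close> for \<open>|m| \<ge> 2\<close> and
  \<open>bl(w w') \<le> bl(w) + bl(w')\<close> only bound a bit-length from above. The function below takes the
  bounds as equalities, i.e. it is the largest choice. The rules leave the exponents \<open>0\<close>, \<open>1\<close>, \<open>-1\<close>
  open; they are free of charge here, so that \<open>bl(w\<^sup>-\<^sup>1) = bl(w)\<close>.\<close>

primrec bl :: "'x pword \<Rightarrow> real" where
  "bl (Gen x) = 1"
| "bl (Mul u v) = bl u + bl v"
| "bl (Pow w m) = bl w + (if m \<in> {-1, 0, 1} then 0 else log 2 \<bar>of_int m\<bar>)"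


section \<open>Presentations\<close>

text \<open>A presentation is a pair of a set \<open>X\<close> of generators and a set \<open>R\<close> of relators: \<open>w \<in> R\<close>
  is the relation \<open>w = 1\<close>, and \<open>u = v\<close> is written as the relator \<open>Mul u (Pow v (-1))\<close>.
  Relators are expressions, since the bit-length depends on how they are written.\<close>

definition normal_closure :: "('a, 'b) monoid_scheme \<Rightarrow> 'a set \<Rightarrow> 'a set" where
  "normal_closure G S =
     generate G {g \<otimes>\<^bsub>G\<^esub> s \<otimes>\<^bsub>G\<^esub> inv\<^bsub>G\<^esub> g | g s. g \<in> carrier G \<and> s \<in> S}"

definition presented_group :: "'x set \<Rightarrow> 'x pword set \<Rightarrow> 'x letter list set monoid" where
  "presented_group X R =
     free_group X Mod
     normal_closure (free_group X) (pword_val (free_group X) (\<lambda>x. [(x, True)]) ` R)"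

definition is_presentation ::
    "('a, 'b) monoid_scheme \<Rightarrow> 'x set \<Rightarrow> 'x pword set \<Rightarrow> bool" where
  "is_presentation G X R \<longleftrightarrow>
     finite X \<and> finite R \<and> (\<forall>r\<in>R. set_pword r \<subseteq> X) \<and> presented_group X R \<cong> G"

definition presentation_bl :: "'x set \<Rightarrow> 'x pword set \<Rightarrow> real" where
  "presentation_bl X R = real (card X) + (\<Sum>r\<in>R. bl r)"

lemma pword_val_closed:
  assumes "group G" "f ` set_pword w \<subseteq> carrier G"
  shows "pword_val G f w \<in> carrier G"
proof -
  interpret group G by fact
  show ?thesis using assms(2) by (induction w) auto
qed

lemma (in group) normal_normal_closure:
  assumes "S \<subseteq> carrier G"
  shows "normal_closure G S \<lhd> G"
  unfolding normal_closure_def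
proof (rule normal_generateI)
  show "{g \<otimes> s \<otimes> inv g | g s. g \<in> carrier G \<and> s \<in> S} \<subseteq> carrier G"
    using assms by auto
next
  fix h k
  assume "h \<in> {g \<otimes> s \<otimes> inv g | g s. g \<in> carrier G \<and> s \<in> S}" and k: "k \<in> carrier G"
  then obtain g s where h: "h = g \<otimes> s \<otimes> inv g" "g \<in> carrier G" "s \<in> S" by blast
  then have "k \<otimes> h \<otimes> inv k = (k \<otimes> g) \<otimes> s \<otimes> inv (k \<otimes> g)"
    using assms k by (simp add: subset_iff m_assoc inv_mult_group)
  then show "k \<otimes> h \<otimes> inv k \<in> {g \<otimes> s \<otimes> inv g | g s. g \<in> carrier G \<and> s \<in> S}"
    using h k by blast
qed

lemma group_presented_group:
  assumes "\<forall>r\<in>R. set_pword r \<subseteq> X"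
  shows "group (presented_group X R)"
proof -
  interpret F: group "free_group X" by (rule group_free_group)
  have gens: "(\<lambda>x. [(x, True)]) ` set_pword r \<subseteq> carrier (free_group X)" if "r \<in> R" for r
  proof (rule image_subsetI)
    fix x assume "x \<in> set_pword r"
    then have "x \<in> X" using assms that by blast
    then show "[(x, True)] \<in> carrier (free_group X)" by (simp add: free_group_def reduced_def)
  qed
  have "pword_val (free_group X) (\<lambda>x. [(x, True)]) ` R \<subseteq> carrier (free_group X)"
    by (rule image_subsetI, rule pword_val_closed[OF F.is_group gens])
  then show ?thesis
    unfolding presented_group_def
    by (rule normal.factorgroup_is_group[OF F.normal_normal_closure])
qed


section \<open>One-dimensional affine groups\<close>

text \<open>\<open>AGL1 F\<close> is the group of affine permutations of the field \<open>F\<close>, and \<open>AGL1_sq F\<close> its subgroup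
  of maps with nonzero square multiplier.\<close>

definition AGL1 :: "('a, 'b) ring_scheme \<Rightarrow> ('a \<Rightarrow> 'a) monoid" where
  "AGL1 F = BijGroup (carrier F)
     \<lparr>carrier := {\<lambda>x\<in>carrier F. a \<otimes>\<^bsub>F\<^esub> x \<oplus>\<^bsub>F\<^esub> b | a b.
                    a \<in> carrier F - {\<zero>\<^bsub>F\<^esub>} \<and> b \<in> carrier F}\<rparr>"

definition AGL1_sq :: "('a, 'b) ring_scheme \<Rightarrow> ('a \<Rightarrow> 'a) monoid" where
  "AGL1_sq F = AGL1 F
     \<lparr>carrier := {\<lambda>x\<in>carrier F. a \<otimes>\<^bsub>F\<^esub> x \<oplus>\<^bsub>F\<^esub> b | a b.
                    a \<in> {c \<otimes>\<^bsub>F\<^esub> c | c. c \<in> carrier F - {\<zero>\<^bsub>F\<^esub>}} \<and> b \<in> carrier F}\<rparr>"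

end

theory Submission
  imports
    Defs
    "HOL-Combinatorics.Permutations"
    "HOL-Number_Theory.Residue_Primitive_Roots"
begin

text \<open>Carmichael: if \<open>x\<^sub>1, \<dots>, x\<^sub>n\<close> satisfy \<open>x\<^sub>i\<^sup>3 = (x\<^sub>i x\<^sub>j)\<^sup>2 = 1\<close>, they generate a quotient of
  \<open>A\<^bsub>n+2\<^esub>\<close>, as a coset enumeration over the subgroup generated by all but one of them shows. For
  \<open>p \<equiv> 3\<close> modulo 4 the group \<open>T = AGL(1,p)\<^sup>(\<^sup>2\<^sup>)\<close> is regular on the unordered pairs of points, so in
  \<open>A\<^bsub>p+2\<^esub> \<times> T\<close>, generated by \<open>A\<^bsub>p+2\<^esub>\<close> and a diagonal copy of \<open>T\<close>, one pair relation is enough. With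
  \<open>q = (p - 1) / 2\<close>, \<open>T\<close> is generated by a translation \<open>x\<close> and a scaling \<open>y\<close> of order \<open>q\<close>, which commutes
  with the 3-cycle \<open>z\<close> of a point fixed by \<open>y\<close>. As \<open>3\<close> does not divide \<open>q\<close>, both \<open>y\<close> and \<open>z\<close> are powers
  \<open>g\<^sup>3\<close> and \<open>g\<^sup>q\<close> of one element \<open>g\<close>; this makes \<open>[y, z] = 1\<close> automatic, and \<open>x\<^sup>p = g\<^sup>3\<^sup>q\<close> supplies the
  orders of \<open>x\<close>, \<open>y\<close> and \<open>z\<close> at once. Finally, \<open>y\<close> times two conjugates of \<open>z\<close> has order \<open>q + 1\<close> in the
  factor \<open>A\<^bsub>p+2\<^esub>\<close>, while its image in \<open>T\<close> has order \<open>q\<close>; imposing that its \<open>(q + 1)\<close>-st power is trivial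
  kills exactly the factor \<open>T\<close>.\<close>

section \<open>Carmichael's relations\<close>

text \<open>Serves coset enumerations: \<open>T\<close> will be a set of products not known to be a
  subgroup, so only left multiplication by generators is tested. Inverses come for free because they
  are natural powers of the generators.\<close>

lemma (in group) generate_subset_if_left_closed:
  assumes S: "S \<subseteq> carrier G" and one: "\<one> \<in> T"
    and closed: "\<And>s t. s \<in> S \<Longrightarrow> t \<in> T \<Longrightarrow> s \<otimes> t \<in> T"
    and inv: "\<And>s. s \<in> S \<Longrightarrow> \<exists>k::nat. inv s = s [^] k"
    and T: "T \<subseteq> carrier G"
  shows "generate G S \<subseteq> T"
proof -
  have pow: "s [^] (k::nat) \<otimes> t \<in> T" if "s \<in> S" "t \<in> T" for s t k
    using that(2)
  proof (induction k arbitrary: t)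
    case 0
    then show ?case using T by auto
  next
    case (Suc k)
    have "s \<in> carrier G" "t \<in> carrier G" using S T that(1) Suc.prems by auto
    then show ?case using Suc.IH[OF closed[OF that(1) Suc.prems]] by (simp add: m_assoc)
  qed
  have "g \<otimes> t \<in> T" if "g \<in> generate G S" "t \<in> T" for g t
    using that
  proof (induction g arbitrary: t rule: generate.induct)
    case one
    then show ?case using T by auto
  next
    case (incl h)
    then show ?case using closed by blast
  next
    case (inv h)
    then show ?case using pow assms(4) by metis
  next
    case (eng h1 h2)
    have "h1 \<in> carrier G" "h2 \<in> carrier G" "t \<in> carrier G"
      using eng generate_in_carrier[OF S] T by auto
    then show ?case using eng by (simp add: m_assoc)
  qed
  then have "g \<in> T" if "g \<in> generate G S" for g
    using that one generate_in_carrier[OF S that] r_one by metis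
  then show ?thesis by blast
qed

text \<open>Turns the relation into a rewriting rule that interchanges two generators at the cost of
  inverting both.\<close>

lemma (in group) square_mult_eq_one_iff:
  assumes "a \<in> carrier G" "b \<in> carrier G"
  shows "(a \<otimes> b) [^] (2::nat) = \<one> \<longleftrightarrow> b \<otimes> a = inv a \<otimes> inv b"
proof -
  have "(a \<otimes> b) [^] (2::nat) = a \<otimes> (b \<otimes> a) \<otimes> b"
    using assms by (simp add: numeral_2_eq_2 m_assoc)
  also have "\<dots> = \<one> \<longleftrightarrow> b \<otimes> a = inv a \<otimes> inv b"
    using assms by (metis inv_closed inv_equality inv_inv inv_mult_group inv_solve_left' l_inv m_assoc m_closed r_inv r_one)
  finally show ?thesis .
qed

lemma (in group) square_mult_commute:
  assumes "a \<in> carrier G" "b \<in> carrier G" "(a \<otimes> b) [^] (2::nat) = \<one>"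
  shows "(b \<otimes> a) [^] (2::nat) = \<one>"
proof -
  have "b \<otimes> a = inv (b \<otimes> a)"
    using assms square_mult_eq_one_iff[of a b] by (simp add: inv_mult_group)
  then have "(b \<otimes> a) \<otimes> (b \<otimes> a) = \<one>"
    using assms(1,2) by (metis m_closed r_inv)
  then show ?thesis using assms(1,2) by (simp add: numeral_2_eq_2)
qed

lemma (in group) inv_eq_square:
  assumes "a \<in> carrier G" "a [^] (3::nat) = \<one>"
  shows "inv a = a \<otimes> a"
  using assms by (intro inv_equality) (simp_all add: numeral_3_eq_3)

text \<open>By induction: adjoining one more element multiplies the order by at most
  \<open>n + 3\<close>, the index of the alternating group of degree n + 2 in that of degree n + 3.
  The factor 2 avoids halving the factorial.\<close>

lemma (in group) card_generate_carmichael: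
  assumes "\<And>i. i < n \<Longrightarrow> f i \<in> carrier G"
    and "\<And>i. i < n \<Longrightarrow> f i [^] (3::nat) = \<one>"
    and "\<And>i j. i < n \<Longrightarrow> j < n \<Longrightarrow> i \<noteq> j \<Longrightarrow> (f i \<otimes> f j) [^] (2::nat) = \<one>"
  shows "finite (generate G (f ` {..<n})) \<and> 2 * card (generate G (f ` {..<n})) \<le> fact (n + 2)"
  using assms
proof (induction n)
  case 0
  have "generate G {} = {\<one>}" by (rule generate_empty)
  then show ?case by simp
next
  case (Suc n)
  define N where "N = generate G (f ` {..<n})"
  define a where "a = f n"
  \<comment> \<open>Representatives for the left cosets of \<open>N\<close>. In the model by
    3-cycles, \<open>N\<close> fixes the new point, and these elements carry it to itself, to the
    two points common to all cycles, and to the older points.\<close>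
  define C where "C = {\<one>, a, inv a} \<union> (\<lambda>j. f j \<otimes> inv a) ` {..<n}"
  define T where "T = (\<lambda>(c, u). c \<otimes> u) ` (C \<times> N)"
  have f: "f i \<in> carrier G" "inv (f i) = f i \<otimes> f i" if "i < Suc n" for i
    using Suc.prems that inv_eq_square by auto
  have rel: "f j \<otimes> f i = inv (f i) \<otimes> inv (f j)" if "i < Suc n" "j < Suc n" "i \<noteq> j" for i j
    using Suc.prems(3)[OF that] square_mult_eq_one_iff[OF f(1) f(1)] that by blast
  have a: "a \<in> carrier G" "inv a = a \<otimes> a" using f[of n] by (auto simp: a_def)
  have rela: "f j \<otimes> a = inv a \<otimes> inv (f j)" "a \<otimes> f j = inv (f j) \<otimes> inv a" if "j < n" for j
    using rel[of n j] rel[of j n] that by (auto simp: a_def)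
  have IH: "finite N" "2 * card N \<le> fact (n + 2)"
    using Suc.IH[OF Suc.prems] by (simp_all add: N_def)
  have fsub: "f ` {..<n} \<subseteq> carrier G" using f by auto
  interpret N: subgroup N G unfolding N_def by (rule generate_is_subgroup[OF fsub])
  have fN: "f j \<in> N" if "j < n" for j unfolding N_def using that by (auto intro: generate.incl)
  have NG: "u \<in> carrier G" if "u \<in> N" for u using that by (rule N.mem_carrier)
  have CG: "C \<subseteq> carrier G" using a f by (auto simp: C_def)
  have TG: "T \<subseteq> carrier G" using CG NG by (auto simp: T_def)
  have TI: "c \<otimes> u \<in> T" if "c \<in> C" "u \<in> N" for c u using that by (auto simp: T_def)
  have C_mem: "\<one> \<in> C" "a \<in> C" "inv a \<in> C" "j < n \<Longrightarrow> f j \<otimes> inv a \<in> C" for j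
    by (auto simp: C_def)
  have step: "f k \<otimes> (c \<otimes> u) \<in> T" if k: "k < Suc n" and c: "c \<in> C" and u: "u \<in> N" for k c u
  proof -
    have uG: "u \<in> carrier G" using u NG by blast
    \<comment> \<open>The factor on the left is the new element or an old one, and \<open>c\<close>
      is any representative. The case where \<open>f k\<close> meets its own index is separate,
      because the pair relation needs distinct indices.\<close>
    consider "k = n" "c = \<one>" | "k = n" "c = a" | "k = n" "c = inv a"
      | j where "k = n" "j < n" "c = f j \<otimes> inv a"
      | "k < n" "c = \<one>" | "k < n" "c = a" | "k < n" "c = inv a"
      | "k < n" "c = f k \<otimes> inv a"
      | j where "k < n" "j < n" "j \<noteq> k" "c = f j \<otimes> inv a"
      using k c unfolding C_def by (cases "k = n") auto
    then have "\<exists>d\<in>C. \<exists>w\<in>N. f k \<otimes> (c \<otimes> u) = d \<otimes> w"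
    proof cases
      case 1
      then show ?thesis using C_mem(2) u uG a by (intro bexI[of _ a] bexI[of _ u]) (auto simp: a_def)
    next
      case 2
      then show ?thesis using u uG a f
        by (intro bexI[OF _ C_mem(3)] bexI[of _ u]) (auto simp: m_assoc simp flip: a_def)
    next
      case 3
      then show ?thesis using u uG a(1)
        by (intro bexI[OF _ C_mem(1)] bexI[of _ u]) (auto simp: m_assoc[symmetric] simp flip: a_def)
    next
      case 4
      have j: "f j \<in> carrier G" "inv (f j) = f j \<otimes> f j" using f 4 by auto
      have "a \<otimes> (f j \<otimes> inv a) = inv (f j) \<otimes> (inv a \<otimes> inv a)"
        using rela[OF 4(2)] a(1) j(1) by (metis inv_closed m_assoc)
      also have "inv a \<otimes> inv a = a" using a by (metis inv_closed inv_inv inv_mult_group)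
      also have "inv (f j) \<otimes> a = f j \<otimes> (inv a \<otimes> inv (f j))"
        using rela[OF 4(2)] a(1) j by (metis m_assoc)
      finally have "f k \<otimes> (c \<otimes> u) = (f j \<otimes> inv a) \<otimes> (inv (f j) \<otimes> u)"
        using 4 a(1) j(1) uG by (simp add: m_assoc a_def[symmetric]) (metis m_assoc inv_closed m_closed)
      then show ?thesis using C_mem(4)[OF 4(2)] u fN[OF 4(2)] by blast
    next
      case 5
      then show ?thesis using C_mem(1) u uG fN f(1)[OF k] by (intro bexI[OF _ C_mem(1)] bexI[of _ "f k \<otimes> u"]) auto
    next
      case 6
      have "f k \<otimes> (c \<otimes> u) = inv a \<otimes> (inv (f k) \<otimes> u)"
        using rela(1)[OF 6(1)] a(1) f(1)[OF k] uG 6 by (metis inv_closed m_assoc)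
      then show ?thesis using C_mem(3) u fN[OF 6(1)] by blast
    next
      case 7
      have "f k \<otimes> (c \<otimes> u) = f k \<otimes> inv a \<otimes> u" using 7 a(1) f(1)[OF k] uG by (simp add: m_assoc)
      then show ?thesis using C_mem(4)[OF 7(1)] u by blast
    next
      case 8
      have "f k \<otimes> (f k \<otimes> inv a) = inv (f k) \<otimes> inv a"
        using f[OF k] a(1) by (simp add: m_assoc)
      also have "\<dots> = a \<otimes> f k" using rela[OF 8(1)] by simp
      finally have "f k \<otimes> (c \<otimes> u) = a \<otimes> (f k \<otimes> u)"
        using 8 a(1) f(1)[OF k] uG by (metis m_assoc inv_closed m_closed)
      then show ?thesis using C_mem(2) u fN[OF 8(1)] by blast
    next
      case 9
      have j: "f j \<in> carrier G" "inv (f j) = f j \<otimes> f j" using f 9 by auto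
      note k' = f[OF k]
      \<comment> \<open>In the model the 3-cycle of \<open>k\<close> fixes the point
        \<open>j\<close>, so the coset of \<open>f j \<otimes> inv a\<close> must come back. Three
        pair relations leave \<open>inv (f j) \<otimes> f k\<close> as the remainder in
        \<open>N\<close>.\<close>
      have "f k \<otimes> (f j \<otimes> inv a) = inv (f j) \<otimes> (inv (f k) \<otimes> inv a)"
        using rel[of j k] 9 k j a(1) k' by (metis inv_closed m_assoc less_Suc_eq)
      also have "\<dots> = inv (f j) \<otimes> (a \<otimes> f k)" using rela[OF 9(1)] by simp
      also have "\<dots> = f j \<otimes> ((f j \<otimes> a) \<otimes> f k)" using a(1) j k' by (simp add: m_assoc)
      also have "\<dots> = f j \<otimes> inv a \<otimes> (inv (f j) \<otimes> f k)"
        unfolding rela(1)[OF 9(2)] using a(1) j(1) k'(1) by (simp add: m_assoc)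
      finally have "f k \<otimes> (c \<otimes> u) = (f j \<otimes> inv a) \<otimes> (inv (f j) \<otimes> f k \<otimes> u)"
        using 9 a(1) j(1) k'(1) uG by (metis m_assoc inv_closed m_closed)
      then show ?thesis using C_mem(4)[OF 9(2)] u fN[OF 9(2)] fN[OF 9(1)] by blast
    qed
    then show ?thesis using TI by metis
  qed
  have invf: "\<exists>k::nat. inv (f i) = f i [^] k" if "i \<in> {..<Suc n}" for i
    using f[of i] that by (intro exI[of _ 2]) (simp add: numeral_2_eq_2)
  have sub: "generate G (f ` {..<Suc n}) \<subseteq> T"
  proof (rule generate_subset_if_left_closed)
    show "f ` {..<Suc n} \<subseteq> carrier G" using f by auto
    show "\<one> \<in> T" using TI[OF C_mem(1) N.one_closed] by simp
    show "\<exists>k::nat. inv s = s [^] k" if "s \<in> f ` {..<Suc n}" for s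
      using that invf by fast
    show "s \<otimes> t \<in> T" if s: "s \<in> f ` {..<Suc n}" and t: "t \<in> T" for s t
    proof -
      obtain k where "k \<in> {..<Suc n}" "s = f k" using s by blast
      moreover obtain c u where "c \<in> C" "u \<in> N" "t = c \<otimes> u" using t by (auto simp: T_def)
      ultimately show ?thesis using step[of k c u] by simp
    qed
  qed (rule TG)
  have C: "finite C" by (simp add: C_def)
  have "card T \<le> card (C \<times> N)"
    unfolding T_def using C IH(1) by (intro card_image_le) simp
  then have T: "finite T" "card T \<le> card C * card N"
    using C IH(1) by (simp_all add: T_def card_cartesian_product)
  have "card C \<le> card {\<one>, a, inv a} + card ((\<lambda>j. f j \<otimes> inv a) ` {..<n})"
    unfolding C_def by (rule card_Un_le)
  also have "card {\<one>, a, inv a} \<le> 3" by (simp add: card_insert_if)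
  also have "card ((\<lambda>j. f j \<otimes> inv a) ` {..<n}) \<le> n" using card_image_le[of "{..<n}"] by simp
  finally have "card C * card N \<le> (n + 3) * card N" by (simp add: add.commute)
  with T(2) card_mono[OF T(1) sub] have "card (generate G (f ` {..<Suc n})) \<le> (n + 3) * card N"
    by linarith
  moreover have fin: "finite (generate G (f ` {..<Suc n}))" using sub T(1) by (rule finite_subset)
  ultimately have "2 * card (generate G (f ` {..<Suc n})) \<le> (n + 3) * (2 * card N)" by linarith
  also have "\<dots> \<le> (n + 3) * fact (n + 2)" using IH(2) by (rule mult_le_mono2)
  also have "\<dots> = fact (Suc n + 2)" by (simp add: algebra_simps)
  finally show ?case using fin by simp
qed


section \<open>The order of the group with three relators\<close>

definition conjugate :: "('a, 'b) monoid_scheme \<Rightarrow> 'a \<Rightarrow> 'a \<Rightarrow> 'a" where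
  "conjugate G u v = u \<otimes>\<^bsub>G\<^esub> v \<otimes>\<^bsub>G\<^esub> inv\<^bsub>G\<^esub> u"

lemma (in group) conjugate_closed [simp]:
  "u \<in> carrier G \<Longrightarrow> v \<in> carrier G \<Longrightarrow> conjugate G u v \<in> carrier G"
  by (simp add: conjugate_def)

lemma (in group) conjugate_mult:
  assumes "u \<in> carrier G" "v \<in> carrier G" "w \<in> carrier G"
  shows "conjugate G u (v \<otimes> w) = conjugate G u v \<otimes> conjugate G u w"
proof -
  have "inv u \<otimes> (u \<otimes> (w \<otimes> inv u)) = w \<otimes> inv u"
    using assms by (simp flip: m_assoc)
  then show ?thesis using assms by (simp add: conjugate_def m_assoc)
qed

lemma (in group) conjugate_one [simp]: "u \<in> carrier G \<Longrightarrow> conjugate G u \<one> = \<one>"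
  by (simp add: conjugate_def)

lemma (in group) conjugate_by_one [simp]: "v \<in> carrier G \<Longrightarrow> conjugate G \<one> v = v"
  by (simp add: conjugate_def)

lemma (in group) conjugate_conjugate:
  assumes "u \<in> carrier G" "v \<in> carrier G" "w \<in> carrier G"
  shows "conjugate G u (conjugate G v w) = conjugate G (u \<otimes> v) w"
  using assms by (simp add: conjugate_def m_assoc inv_mult_group)

lemma (in group) conjugate_pow:
  assumes "u \<in> carrier G" "v \<in> carrier G"
  shows "conjugate G u (v [^] (k::nat)) = conjugate G u v [^] k"
  using assms by (induction k) (simp_all add: conjugate_mult)

lemma (in group) conjugate_commute:
  assumes "u \<in> carrier G" "v \<in> carrier G" "u \<otimes> v = v \<otimes> u"
  shows "conjugate G u v = v"
  using assms by (simp add: conjugate_def m_assoc)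

lemma (in group) conjugate_eq_iff:
  assumes "u \<in> carrier G" "v \<in> carrier G" "w \<in> carrier G"
  shows "conjugate G u v = w \<longleftrightarrow> u \<otimes> v = w \<otimes> u"
  using assms unfolding conjugate_def by (metis inv_solve_right m_closed)

lemma (in group) conjugate_generate:
  assumes S: "S \<subseteq> carrier G" and u: "u \<in> carrier G"
    and conj: "\<And>s. s \<in> S \<Longrightarrow> conjugate G u s \<in> generate G S"
    and v: "v \<in> generate G S"
  shows "conjugate G u v \<in> generate G S"
  using v
proof (induction rule: generate.induct)
  case one
  then show ?case using u generate.one by simp
next
  case (incl h)
  then show ?case using conj by blast
next
  case (inv h)
  then have h: "h \<in> carrier G" using S by blast
  then have "conjugate G u (inv h) = inv (conjugate G u h)"
    using u by (simp add: conjugate_def inv_mult_group m_assoc)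
  then show ?case using generate_m_inv_closed[OF S conj[OF inv]] by simp
next
  case (eng h1 h2)
  have "h1 \<in> carrier G" "h2 \<in> carrier G" using eng generate_in_carrier[OF S] by auto
  then show ?case using eng generate.eng by (simp add: conjugate_mult u)
qed

lemma (in group) pow_cong:
  assumes "x \<in> carrier G" "x [^] (n::nat) = \<one>" "[a = b] (mod n)"
  shows "x [^] (a::nat) = x [^] b"
proof -
  have "x [^] k = x [^] (k mod n)" for k :: nat
  proof -
    have "x [^] k = x [^] (n * (k div n) + k mod n)" by simp
    also have "\<dots> = (x [^] n) [^] (k div n) \<otimes> x [^] (k mod n)"
      using assms(1) by (simp only: nat_pow_mult nat_pow_pow)
    finally show ?thesis using assms(1,2) by simp
  qed
  then show ?thesis using assms(3) unfolding cong_def by metis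
qed

text \<open>Here \<open>y = g\<^sup>3\<close> and \<open>z = g\<^sup>q\<close>. Modulo \<open>p\<close>, \<open>rt\<close> says that \<open>t + 1\<close> is the inverse of
  \<open>1 - r\<close>, so that \<open>rel2\<close> amounts to \<open>y x y\<^sup>-\<^sup>1 = x\<^sup>r\<close> together with \<open>x\<^sup>p = 1\<close>. The assumption
  \<open>pm_r_pow_diff\<close> is 2-homogeneity: it turns the single relation \<open>rel3\<close> into the relations of all
  pairs of conjugates of \<open>z\<close>.\<close>

locale affine_carmichael = group G for G (structure) +
  fixes x g :: 'a and p q m r t :: nat
  assumes xg: "x \<in> carrier G" "g \<in> carrier G" "generate G {x, g} = carrier G"
    and pos: "p > 0" "q > 0"
    and q3: "q + 1 = 3 * m"
    and rt: "[r * (t + 1) = t] (mod p)"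
    and pm_r_pow_diff: "\<And>i j. i < p \<Longrightarrow> j < p \<Longrightarrow> i \<noteq> j \<Longrightarrow>
                 \<exists>k. [j = i + r ^ k] (mod p) \<or> [i = j + r ^ k] (mod p)"
    and rel1: "x [^] p = g [^] (3 * q)"
    and rel2: "conjugate G (g [^] (3::nat)) (x [^] (t + 1)) = x [^] t"
    and rel3: "(g [^] q \<otimes> conjugate G x (g [^] q)) [^] (2::nat) = \<one>"
begin

section \<open>Consequences of the three relations\<close>

definition "y = g [^] (3::nat)"
definition "z = g [^] q"
text \<open>These conjugates play the role of Carmichael's generators.\<close>

definition "a i = conjugate G (x [^] (i::nat)) z"
definition "N = generate G (a ` {..<p})"

lemma y_closed [simp]: "y \<in> carrier G" and z_closed [simp]: "z \<in> carrier G"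
  and x_closed [simp]: "x \<in> carrier G" and a_closed [simp]: "a i \<in> carrier G"
  using xg by (simp_all add: y_def z_def a_def)

text \<open>By \<open>rel1\<close>, \<open>x [^] p\<close> is a power of \<open>g\<close>, hence
  commutes with \<open>y\<close>. The \<open>p\<close>-th power of \<open>rel2\<close> then equates
  two consecutive powers of \<open>x [^] p\<close>.\<close>

lemma x_pow_p: "x [^] p = \<one>"
proof -
  have "y \<otimes> x [^] p = x [^] p \<otimes> y"
    using xg by (simp add: rel1 y_def nat_pow_mult add.commute)
  then have conj_p: "conjugate G y (x [^] p) = x [^] p" by (simp add: conjugate_commute)
  have "x [^] p \<otimes> (x [^] p) [^] t = (x [^] p) [^] (t + 1)"
    by (simp only: Suc_eq_plus1[symmetric] nat_pow_Suc2 nat_pow_closed x_closed)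
  also have "\<dots> = conjugate G y ((x [^] p) [^] (t + 1))"
    by (simp only: conjugate_pow y_closed x_closed nat_pow_closed conj_p)
  also have "(x [^] p) [^] (t + 1) = (x [^] (t + 1)) [^] p"
    by (simp only: nat_pow_pow x_closed mult.commute)
  also have "conjugate G y \<dots> = (x [^] t) [^] p"
    by (simp only: conjugate_pow y_closed x_closed nat_pow_closed rel2[folded y_def])
  also have "\<dots> = (x [^] p) [^] t"
    by (simp add: nat_pow_pow mult.commute)
  finally show ?thesis by simp
qed

lemma g_pow: "g [^] (3 * q) = \<one>"
  using rel1 x_pow_p by simp

lemma y_pow_q: "y [^] q = \<one>" and z_pow_3: "z [^] (3::nat) = \<one>"
  using xg g_pow by (simp_all add: y_def z_def nat_pow_pow mult.commute)

lemma conjugate_y_x: "conjugate G y (x [^] i) = x [^] (r * i)"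
proof -
  \<comment> \<open>A natural number congruent to 1 - r modulo \<open>p\<close>, hence by
    \<open>rt\<close> inverse to t + 1. So \<open>x\<close> is the \<open>u\<close>-th power of
    \<open>x [^] (t + 1)\<close>, to which \<open>rel2\<close> applies.\<close>
  define u where "u = 1 + r * (p - 1)"
  have p1: "[p - 1 + 1 = 0] (mod p)" using pos by (simp add: cong_def)
  have tu: "[(t + 1) * u = 1 + t * (p - 1 + 1)] (mod p)"
  proof -
    have "(t + 1) * u = (t + 1) + r * (t + 1) * (p - 1)" by (simp add: u_def distrib_left mult.commute mult.left_commute)
    also have "[\<dots> = (t + 1) + t * (p - 1)] (mod p)"
      by (intro cong_add cong_mult cong_refl rt)
    also have "(t + 1) + t * (p - 1) = 1 + t * (p - 1 + 1)" by (simp add: algebra_simps)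
    finally show ?thesis .
  qed
  also have "[1 + t * (p - 1 + 1) = 1 + t * 0] (mod p)"
    by (intro cong_add cong_mult cong_refl p1)
  finally have tu1: "[(t + 1) * u = 1] (mod p)" by simp
  have "[t * u = r * (t + 1) * u] (mod p)"
    using rt by (intro cong_mult cong_refl) (rule cong_sym)
  also have "r * (t + 1) * u = r * ((t + 1) * u)" by (rule mult.assoc)
  also have "[\<dots> = r * 1] (mod p)" using tu1 by (intro cong_mult cong_refl)
  finally have "[t * u = r] (mod p)" by simp
  then have tur: "x [^] (t * u) = x [^] r" by (intro pow_cong[OF _ x_pow_p]) simp_all
  have "x = x [^] (1::nat)" by simp
  also have "\<dots> = x [^] ((t + 1) * u)" by (intro pow_cong[OF _ x_pow_p] cong_sym[OF tu1]) simp
  also have "\<dots> = (x [^] (t + 1)) [^] u" by (simp only: nat_pow_pow x_closed)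
  finally have "conjugate G y x = conjugate G y ((x [^] (t + 1)) [^] u)" by simp
  also have "\<dots> = (x [^] t) [^] u"
    by (simp only: conjugate_pow y_closed x_closed nat_pow_closed rel2[folded y_def])
  also have "\<dots> = x [^] r" by (simp add: nat_pow_pow tur)
  finally show ?thesis by (simp add: conjugate_pow nat_pow_pow)
qed

lemma y_x_pow: "y \<otimes> x [^] i = x [^] (r * i) \<otimes> y"
  using conjugate_y_x by (simp add: conjugate_eq_iff)

lemma conjugate_y_z: "conjugate G y z = z"
  using xg by (intro conjugate_commute) (simp_all add: y_def z_def nat_pow_mult add.commute)

lemma conjugate_x_a: "conjugate G x (a i) = a (Suc i)"
  using nat_pow_Suc2[of x i] by (simp add: a_def conjugate_conjugate)

lemma conjugate_x_pow_a: "conjugate G (x [^] k) (a i) = a (k + i)"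
  by (simp add: a_def conjugate_conjugate nat_pow_mult)

text \<open>As powers of \<open>g\<close>, the elements \<open>y\<close> and \<open>z\<close>
  commute, so only the conjugating power of \<open>x\<close> changes when \<open>y\<close> moves
  past it.\<close>

lemma conjugate_y_a: "conjugate G y (a i) = a (r * i)"
proof -
  have "conjugate G y (a i) = conjugate G (x [^] (r * i) \<otimes> y) z"
    by (simp add: a_def conjugate_conjugate y_x_pow)
  also have "\<dots> = a (r * i)"
    by (simp add: a_def conjugate_y_z flip: conjugate_conjugate)
  finally show ?thesis .
qed

lemma a_cong: "[i = j] (mod p) \<Longrightarrow> a i = a j"
  unfolding a_def using pow_cong[OF x_closed x_pow_p] by metis

lemma a_pow_3: "a i [^] (3::nat) = \<one>"
  using z_pow_3 by (simp add: a_def flip: conjugate_pow)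

text \<open>Conjugation by powers of \<open>y\<close> carries the pair 0, 1 of \<open>rel3\<close>
  to all pairs 0, \<open>r ^ k\<close>, and powers of \<open>x\<close> translate these. By
  \<open>pm_r_pow_diff\<close> every unordered pair is reached, and the order within a pair is
  immaterial.\<close>

lemma a_pair:
  assumes "i < p" "j < p" "i \<noteq> j"
  shows "(a i \<otimes> a j) [^] (2::nat) = \<one>"
proof -
  have base: "(a 0 \<otimes> a (r ^ k)) [^] (2::nat) = \<one>" for k
  proof (induction k)
    case 0
    then show ?case using rel3 by (simp add: a_def z_def[symmetric])
  next
    case (Suc k)
    have "(a 0 \<otimes> a (r ^ Suc k)) [^] (2::nat) = conjugate G y ((a 0 \<otimes> a (r ^ k)) [^] (2::nat))"
      by (simp add: conjugate_pow conjugate_mult conjugate_y_a)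
    then show ?case by (simp add: Suc)
  qed
  have shift: "(a i \<otimes> a j) [^] (2::nat) = \<one>" if "[j = i + r ^ k] (mod p)" for i j k
  proof -
    have "(a i \<otimes> a j) [^] (2::nat) = conjugate G (x [^] i) ((a 0 \<otimes> a (r ^ k)) [^] (2::nat))"
      using a_cong[OF that] by (simp add: conjugate_pow conjugate_mult conjugate_x_pow_a)
    then show ?thesis by (simp add: base)
  qed
  from pm_r_pow_diff[OF assms] obtain k where "[j = i + r ^ k] (mod p) \<or> [i = j + r ^ k] (mod p)" by blast
  then show ?thesis using shift square_mult_commute[of "a j" "a i"] by auto
qed

lemma finite_card_N: "finite N" "2 * card N \<le> fact (p + 2)"
  using card_generate_carmichael[of p a] a_pow_3 a_pair by (simp_all add: N_def)

lemma a_sub: "a ` {..<p} \<subseteq> carrier G" by auto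

lemma a_in_N: "a i \<in> N"
proof -
  have "a i = a (i mod p)" by (rule a_cong) (simp add: cong_def)
  then show ?thesis using pos unfolding N_def by (auto intro: generate.incl)
qed

lemma N_carrier: "n \<in> N \<Longrightarrow> n \<in> carrier G"
  unfolding N_def by (rule generate_in_carrier[OF a_sub])

lemma conjugate_N:
  assumes "n \<in> N" shows "conjugate G x n \<in> N" "conjugate G y n \<in> N"
proof -
  have "conjugate G x s \<in> N" "conjugate G y s \<in> N" if "s \<in> a ` {..<p}" for s
    using that a_in_N by (auto simp: conjugate_x_a conjugate_y_a)
  then show "conjugate G x n \<in> N" "conjugate G y n \<in> N"
    using conjugate_generate[OF a_sub x_closed] conjugate_generate[OF a_sub y_closed] assms
    unfolding N_def by blast+
qed

text \<open>Both \<open>x\<close> and \<open>y\<close> normalise \<open>N\<close>, and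
  \<open>y\<close> conjugates powers of \<open>x\<close> to powers of \<open>x\<close>. Hence the
  products on the right are stable under left multiplication by \<open>x\<close>, \<open>y\<close>
  and \<open>z\<close>, and so by \<open>g\<close>.\<close>

lemma carrier_eq: "carrier G = (\<lambda>(n, i, j). n \<otimes> (x [^] i \<otimes> y [^] j)) ` (N \<times> {..<p} \<times> {..<q})"
  (is "_ = ?T")
proof
  have NN: "n \<otimes> n' \<in> N" if "n \<in> N" "n' \<in> N" for n n'
    using that unfolding N_def by (rule generate.eng)
  have TI: "n \<otimes> (x [^] i \<otimes> y [^] j) \<in> ?T" if "n \<in> N" for n and i j :: nat
  proof -
    have "x [^] i = x [^] (i mod p)" by (intro pow_cong[OF _ x_pow_p]) (simp_all add: cong_def)
    moreover have "y [^] j = y [^] (j mod q)" by (intro pow_cong[OF _ y_pow_q]) (simp_all add: cong_def)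
    ultimately show ?thesis using that pos by (intro image_eqI[of _ _ "(n, i mod p, j mod q)"]) auto
  qed
  show T: "?T \<subseteq> carrier G" using N_carrier by auto
  have TC: "u \<in> carrier G" if "u \<in> ?T" for u using T that by (rule subsetD)
  have z: "z \<otimes> u \<in> ?T" if uT: "u \<in> ?T" for u
  proof -
    obtain n and i j :: nat where u: "n \<in> N" "u = n \<otimes> (x [^] i \<otimes> y [^] j)" using uT by auto
    have "z = a 0" by (simp add: a_def)
    then have "z \<otimes> n \<in> N" using NN u(1) a_in_N by metis
    moreover have "z \<otimes> u = (z \<otimes> n) \<otimes> (x [^] i \<otimes> y [^] j)"
      using N_carrier[OF u(1)] by (simp add: u(2) m_assoc)
    ultimately show ?thesis using TI by metis
  qed
  have x: "x \<otimes> u \<in> ?T" if uT: "u \<in> ?T" for u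
  proof -
    obtain n and i j :: nat where u: "n \<in> N" "u = n \<otimes> (x [^] i \<otimes> y [^] j)" using uT by auto
    note n = N_carrier[OF u(1)]
    have "x \<otimes> n = conjugate G x n \<otimes> x" using n by (simp add: conjugate_def m_assoc)
    then have "x \<otimes> u = conjugate G x n \<otimes> (x [^] Suc i \<otimes> y [^] j)"
      unfolding nat_pow_Suc2[OF x_closed] u(2) using n by (simp flip: m_assoc)
    then show ?thesis using TI conjugate_N(1)[OF u(1)] by metis
  qed
  have y: "y \<otimes> u \<in> ?T" if uT: "u \<in> ?T" for u
  proof -
    obtain n and i j :: nat where u: "n \<in> N" "u = n \<otimes> (x [^] i \<otimes> y [^] j)" using uT by auto
    note n = N_carrier[OF u(1)]
    have "y \<otimes> n = conjugate G y n \<otimes> y" using n by (simp add: conjugate_def m_assoc)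
    then have "y \<otimes> u = conjugate G y n \<otimes> ((y \<otimes> x [^] i) \<otimes> y [^] j)"
      using n unfolding u(2) by (simp flip: m_assoc)
    also have "(y \<otimes> x [^] i) \<otimes> y [^] j = x [^] (r * i) \<otimes> y [^] Suc j"
      unfolding y_x_pow nat_pow_Suc2[OF y_closed] by (simp add: m_assoc)
    finally show ?thesis using TI conjugate_N(2)[OF u(1)] by metis
  qed
  have ypow: "y [^] (k::nat) \<otimes> u \<in> ?T" if "u \<in> ?T" for u k
    using that
  proof (induction k)
    case 0
    then show ?case using TC[OF 0] by simp
  next
    case (Suc k)
    have "y [^] Suc k \<otimes> u = y \<otimes> (y [^] k \<otimes> u)"
      using TC[OF Suc.prems] unfolding nat_pow_Suc2[OF y_closed] by (simp add: m_assoc)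
    then show ?case using y[OF Suc.IH[OF Suc.prems]] by simp
  qed
  have g: "g \<otimes> u \<in> ?T" if "u \<in> ?T" for u
  proof -
    \<comment> \<open>Recovers \<open>g\<close> from \<open>y\<close> and \<open>z\<close>: by
      \<open>q3\<close> the total exponent 3m + 2q equals 3q + 1, and \<open>g [^] (3 * q)\<close>
      is trivial.\<close>
    have "y [^] m \<otimes> (z \<otimes> z) = g [^] (3 * m + (q + q))"
      using xg by (simp add: y_def z_def nat_pow_pow nat_pow_mult)
    also have "3 * m + (q + q) = 3 * q + 1" using q3 by simp
    also have "g [^] (3 * q + 1) = g" using xg g_pow by simp
    finally have "g = y [^] m \<otimes> (z \<otimes> z)" by (rule sym)
    then have "g \<otimes> u = y [^] m \<otimes> (z \<otimes> z) \<otimes> u" by (rule arg_cong)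
    also have "\<dots> = y [^] m \<otimes> (z \<otimes> (z \<otimes> u))"
      using TC[OF that] by (simp add: m_assoc)
    finally have "g \<otimes> u = y [^] m \<otimes> (z \<otimes> (z \<otimes> u))" .
    then show ?thesis using ypow[OF z[OF z[OF that]]] by simp
  qed
  have "generate G {x, g} \<subseteq> ?T"
  proof (rule generate_subset_if_left_closed)
    have "\<one> \<in> N" unfolding N_def by (rule generate.one)
    then show "\<one> \<in> ?T" using TI[of \<one> 0 0] by simp
    show "s \<otimes> t \<in> ?T" if "s \<in> {x, g}" "t \<in> ?T" for s t using that x g by blast
    have "inv x = x [^] (p - 1)"
    proof (rule inv_equality)
      have "x [^] (p - 1) \<otimes> x = x [^] Suc (p - 1)" by simp
      then show "x [^] (p - 1) \<otimes> x = \<one>" using pos x_pow_p by simp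
    qed simp_all
    moreover have "inv g = g [^] (3 * q - 1)"
    proof (rule inv_equality)
      have "g [^] (3 * q - 1) \<otimes> g = g [^] Suc (3 * q - 1)" by simp
      then show "g [^] (3 * q - 1) \<otimes> g = \<one>" using pos g_pow by simp
    qed (use xg in simp_all)
    ultimately show "\<exists>k::nat. inv s = s [^] k" if "s \<in> {x, g}" for s using that by blast
  qed (use xg T in auto)
  then show "carrier G \<subseteq> ?T" using xg by simp
qed

lemma finite_carrier: "finite (carrier G)"
  unfolding carrier_eq using finite_card_N by simp

lemma card_carrier_le: "2 * card (carrier G) \<le> fact (p + 2) * (p * q)"
proof -
  have "card (carrier G) \<le> card (N \<times> {..<p} \<times> {..<q})"
    unfolding carrier_eq using finite_card_N by (intro card_image_le) simp
  also have "\<dots> = card N * (p * q)" by (simp add: card_cartesian_product)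
  finally have "2 * card (carrier G) \<le> (2 * card N) * (p * q)" by simp
  also have "\<dots> \<le> fact (p + 2) * (p * q)" using finite_card_N by (intro mult_le_mono1)
  finally show ?thesis .
qed

end


section \<open>Presented groups\<close>

abbreviation free_gen :: "'x \<Rightarrow> 'x letter list" where
  "free_gen x \<equiv> [(x, True)]"

lemma free_gen_closed [simp]: "free_gen x \<in> carrier (free_group X) \<longleftrightarrow> x \<in> X"
  by (simp add: free_group_def reduced_def)

text \<open>In a reduced list the first letter does not cancel against the rest, so the list is the
  product of its letters.\<close>

lemma free_group_generated: "generate (free_group X) (free_gen ` X) = carrier (free_group X)"
proof
  interpret F: group "free_group X" by (rule group_free_group)
  show "generate (free_group X) (free_gen ` X) \<subseteq> carrier (free_group X)"
    by (rule F.generate_incl) auto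
  have letter: "[l] \<in> generate (free_group X) (free_gen ` X)" if "fst l \<in> X" for l
  proof (cases "snd l")
    case True
    then have "[l] = free_gen (fst l)" by (cases l) simp
    then show ?thesis using that by (auto intro: generate.incl)
  next
    case False
    then have "[l] = [(fst l, False)]" by (cases l) simp
    also have "\<dots> = inv\<^bsub>free_group X\<^esub> free_gen (fst l)"
      using that by (intro F.inv_equality[symmetric])
        (auto simp: free_group_def reduced_def letter_inv_def)
    finally show ?thesis using that by (auto intro: generate.inv)
  qed
  show "carrier (free_group X) \<subseteq> generate (free_group X) (free_gen ` X)"
  proof
    fix w assume "w \<in> carrier (free_group X)"
    then show "w \<in> generate (free_group X) (free_gen ` X)"
    proof (induction w)
      case Nil
      then show ?case using generate.one[of "free_group X"] by (simp add: free_group_def)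
    next
      case (Cons l w)
      then have w: "w \<in> carrier (free_group X)" and l: "fst l \<in> X" and red: "reduced (l # w)"
        by (auto simp: free_group_def reduced_def successively_Cons)
      have "[l] \<otimes>\<^bsub>free_group X\<^esub> w = l # w"
        using red by (cases w) (auto simp: free_group_def reduced_def successively_Cons)
      then show ?case using generate.eng[OF letter[OF l] Cons.IH[OF w]] by simp
    qed
  qed
qed

definition free_lift :: "('a, 'b) monoid_scheme \<Rightarrow> ('x \<Rightarrow> 'a) \<Rightarrow> 'x letter list \<Rightarrow> 'a" where
  "free_lift G f w =
     foldr (\<lambda>l v. (if snd l then f (fst l) else inv\<^bsub>G\<^esub> f (fst l)) \<otimes>\<^bsub>G\<^esub> v) w \<one>\<^bsub>G\<^esub>"

lemma free_lift_gen:
  assumes "group G" "f x \<in> carrier G"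
  shows "free_lift G f (free_gen x) = f x"
  using assms by (simp add: free_lift_def group.is_monoid monoid.r_one)

text \<open>The point is \<open>cons_letter\<close>: when a letter cancels against the head of a
  list, so do their values. Multiplicativity follows by induction on the left factor.\<close>

lemma free_lift_hom:
  fixes G (structure)
  assumes "group G" and f: "f ` X \<subseteq> carrier G"
  shows "free_lift G f \<in> hom (free_group X) G"
proof -
  interpret group G by fact
  let ?e = "\<lambda>l. if snd l then f (fst l) else inv f (fst l)"
  have e: "?e l \<in> carrier G" if "fst l \<in> X" for l using that f by auto
  have closed: "free_lift G f w \<in> carrier G" if "fst ` set w \<subseteq> X" for w
    using that e by (induction w) (auto simp: free_lift_def)
  have cons: "free_lift G f (cons_letter l w) = ?e l \<otimes> free_lift G f w"
    if "fst l \<in> X" "fst ` set w \<subseteq> X" for l w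
  proof (cases w)
    case Nil
    then show ?thesis by (simp add: free_lift_def)
  next
    case (Cons m v)
    show ?thesis
    proof (cases "m = letter_inv l")
      case True
      have "free_lift G f v \<in> carrier G" using that Cons by (intro closed) auto
      then have "?e l \<otimes> (?e (letter_inv l) \<otimes> free_lift G f v) = free_lift G f v"
        using that(1) f by (auto simp: letter_inv_def subset_iff simp flip: m_assoc)
      then show ?thesis using Cons True by (simp add: free_lift_def)
    qed (simp add: Cons free_lift_def)
  qed
  have foldr: "free_lift G f (foldr cons_letter u v) = free_lift G f u \<otimes> free_lift G f v"
    if "fst ` set u \<subseteq> X" "fst ` set v \<subseteq> X" for u v
    using that
  proof (induction u)
    case Nil
    then show ?case using closed[of v] by (simp add: free_lift_def)
  next
    case (Cons l u)
    have "fst ` set (foldr cons_letter u v) \<subseteq> X"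
      using set_foldr[of u v] Cons.prems by fastforce
    then have "free_lift G f (foldr cons_letter (l # u) v)
        = ?e l \<otimes> free_lift G f (foldr cons_letter u v)"
      using Cons.prems by (simp add: cons del: if_split)
    also have "\<dots> = ?e l \<otimes> (free_lift G f u \<otimes> free_lift G f v)"
      using Cons by simp
    also have "\<dots> = (?e l \<otimes> free_lift G f u) \<otimes> free_lift G f v"
      using e[of l] closed[of u] closed[of v] Cons.prems by (intro m_assoc[symmetric]) auto
    finally show ?case by (simp add: free_lift_def)
  qed
  show ?thesis
    using closed foldr by (intro homI) (auto simp: free_group_def)
qed

lemma hom_pword_val:
  assumes "group G" "group H" "h \<in> hom G H" "f ` set_pword w \<subseteq> carrier G"
  shows "h (pword_val G f w) = pword_val H (h \<circ> f) w"
  using assms(4)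
proof (induction w)
  case (Mul u v)
  then show ?case
    using hom_mult[OF assms(3)] pword_val_closed[OF assms(1), of f u]
      pword_val_closed[OF assms(1), of f v] by (simp add: image_Un)
next
  case (Pow w m)
  then show ?case
    using hom_int_pow[OF assms(3) _ assms(1,2)] pword_val_closed[OF assms(1), of f w] by simp
qed simp

lemma pword_val_cong:
  assumes "\<And>x. x \<in> set_pword w \<Longrightarrow> f x = f' x"
  shows "pword_val G f w = pword_val G f' w"
  using assms by (induction w) auto

section \<open>Relators and von Dyck's theorem\<close>

definition relators :: "'x set \<Rightarrow> 'x pword set \<Rightarrow> 'x letter list set" where
  "relators X R = normal_closure (free_group X) (pword_val (free_group X) free_gen ` R)"

lemma presented_group_eq: "presented_group X R = free_group X Mod relators X R"
  by (simp add: presented_group_def relators_def)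

lemma pword_val_free_closed:
  "set_pword r \<subseteq> X \<Longrightarrow> pword_val (free_group X) free_gen r \<in> carrier (free_group X)"
  by (rule pword_val_closed[OF group_free_group]) auto

lemma normal_relators:
  assumes "\<And>r. r \<in> R \<Longrightarrow> set_pword r \<subseteq> X"
  shows "relators X R \<lhd> free_group X"
  unfolding relators_def
  by (rule group.normal_normal_closure[OF group_free_group], rule image_subsetI)
     (rule pword_val_free_closed, rule assms)

lemma (in group) normal_closure_incl:
  assumes "S \<subseteq> carrier G" "s \<in> S"
  shows "s \<in> normal_closure G S"
proof -
  have "\<one> \<otimes> s \<otimes> inv \<one> = s" using assms by auto
  then show ?thesis unfolding normal_closure_def using assms(2) by (intro generate.incl) force
qed

lemma relator_mem:
  assumes "\<And>r. r \<in> R \<Longrightarrow> set_pword r \<subseteq> X" "r \<in> R"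
  shows "pword_val (free_group X) free_gen r \<in> relators X R"
  unfolding relators_def
proof (rule group.normal_closure_incl[OF group_free_group])
  show "pword_val (free_group X) free_gen ` R \<subseteq> carrier (free_group X)"
    by (rule image_subsetI) (rule pword_val_free_closed, rule assms)
qed (use assms(2) in simp)

lemma (in group) normal_closure_subset:
  assumes "N \<lhd> G" "S \<subseteq> N"
  shows "normal_closure G S \<subseteq> N"
  unfolding normal_closure_def
proof (rule generate_subgroup_incl)
  show "subgroup N G" using assms(1) by (rule normal_imp_subgroup)
  show "{g \<otimes> s \<otimes> inv g |g s. g \<in> carrier G \<and> s \<in> S} \<subseteq> N"
  proof clarify
    fix g s assume "g \<in> carrier G" "s \<in> S"
    then show "g \<otimes> s \<otimes> inv g \<in> N"
      using assms(2) by (intro normal.inv_op_closed2[OF assms(1)]) auto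
  qed
qed

lemma relators_mono:
  assumes "\<And>r. r \<in> R' \<Longrightarrow> set_pword r \<subseteq> X" "R \<subseteq> R'"
  shows "relators X R \<subseteq> relators X R'"
  unfolding relators_def[of X R]
proof (rule group.normal_closure_subset[OF group_free_group normal_relators])
  show "pword_val (free_group X) free_gen ` R \<subseteq> relators X R'"
    by (rule image_subsetI) (rule relator_mem, use assms in auto)
qed (rule assms)

text \<open>The hypotheses of von Dyck's theorem, under which \<open>K\<close> is a quotient of the
  presented group. To get a presentation of \<open>K\<close>, it remains to bound the kernel by the
  relators.\<close>

locale presentation_data =
  fixes K (structure) and f :: "'x \<Rightarrow> 'a" and X :: "'x set" and R :: "'x pword set"
  assumes group_K: "group K"
    and finite_X: "finite X" and finite_R: "finite R"
    and words: "\<And>r. r \<in> R \<Longrightarrow> set_pword r \<subseteq> X"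
    and f_closed: "f ` X \<subseteq> carrier K"
    and f_gen: "generate K (f ` X) = carrier K"
    and holds: "\<And>r. r \<in> R \<Longrightarrow> pword_val K f r = \<one>"
begin

sublocale lift: group_hom "free_group X" K "free_lift K f"
  using group_free_group group_K free_lift_hom[OF group_K f_closed]
  by (simp add: group_hom_def group_hom_axioms_def)

lemma lift_gen: "x \<in> X \<Longrightarrow> free_lift K f (free_gen x) = f x"
  using f_closed by (intro free_lift_gen[OF group_K]) auto

lemma lift_surj: "free_lift K f ` carrier (free_group X) = carrier K"
proof -
  have "free_lift K f ` carrier (free_group X) = generate K (free_lift K f ` free_gen ` X)"
    by (subst lift.generate_img) (auto simp only: free_group_generated free_gen_closed)
  also have "free_lift K f ` free_gen ` X = f ` X"
    unfolding image_image by (rule image_cong[OF refl lift_gen])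
  finally show ?thesis using f_gen by simp
qed

lemma lift_pword_val:
  assumes "set_pword w \<subseteq> X"
  shows "free_lift K f (pword_val (free_group X) free_gen w) = pword_val K f w"
proof -
  have "free_lift K f (pword_val (free_group X) free_gen w)
      = pword_val K (free_lift K f \<circ> free_gen) w"
    using assms by (intro hom_pword_val[OF group_free_group group_K lift.homh]) auto
  also have "\<dots> = pword_val K f w"
    using assms lift_gen by (intro pword_val_cong) auto
  finally show ?thesis .
qed

lemma relators_le_kernel: "relators X R \<subseteq> kernel (free_group X) K (free_lift K f)"
  unfolding relators_def
proof (rule lift.G.normal_closure_subset[OF lift.normal_kernel], rule image_subsetI)
  fix r assume "r \<in> R"
  then show "pword_val (free_group X) free_gen r \<in> kernel (free_group X) K (free_lift K f)"
    using words[of r] holds[of r] lift_pword_val[of r] pword_val_free_closed[of r X]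
    by (simp add: kernel_def)
qed

lemma is_presentation_if_kernel_le:
  assumes "kernel (free_group X) K (free_lift K f) \<subseteq> relators X R"
  shows "is_presentation K X R"
proof -
  have "presented_group X R \<cong> K"
    unfolding presented_group_eq using lift.FactGroup_iso[OF lift_surj] relators_le_kernel assms
    by (metis subset_antisym)
  then show ?thesis using finite_X finite_R words by (auto simp: is_presentation_def)
qed

text \<open>The presented group maps onto \<open>K\<close>; being finite and no larger than
  \<open>K\<close>, it maps injectively, so the kernel is trivial modulo the relators.\<close>

lemma kernel_le_if_card_le:
  assumes "finite (carrier (presented_group X R))"
    and "card (carrier (presented_group X R)) \<le> card (carrier K)"
  shows "kernel (free_group X) K (free_lift K f) \<subseteq> relators X R"
proof
  let ?N = "relators X R" let ?F = "free_group X"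
  note N = normal_relators[OF words]
  interpret N: normal ?N ?F by (rule N)
  obtain g where "g \<in> hom (?F Mod ?N) K"
    and g: "\<And>u. u \<in> carrier ?F \<Longrightarrow> g (?N #>\<^bsub>?F\<^esub> u) = free_lift K f u"
    using lift.FactGroup_universal_kernel[OF N relators_le_kernel] by blast
  have P: "carrier (presented_group X R) = (\<lambda>u. ?N #>\<^bsub>?F\<^esub> u) ` carrier ?F"
    by (auto simp: presented_group_eq FactGroup_def RCOSETS_def)
  have "g ` carrier (presented_group X R) = carrier K"
    unfolding P image_image using g lift_surj by simp
  then have inj: "inj_on g (carrier (presented_group X R))"
    using assms by (metis eq_card_imp_inj_on card_image_le le_antisym)
  fix u assume "u \<in> kernel (free_group X) K (free_lift K f)"
  then have u: "u \<in> carrier ?F" "free_lift K f u = \<one>" by (auto simp: kernel_def)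
  then have "g (?N #>\<^bsub>?F\<^esub> u) = g (?N #>\<^bsub>?F\<^esub> \<one>\<^bsub>?F\<^esub>)" by (simp add: g)
  then have "?N #>\<^bsub>?F\<^esub> u = ?N #>\<^bsub>?F\<^esub> \<one>\<^bsub>?F\<^esub>"
    using u by (intro inj_onD[OF inj]) (auto simp: P)
  then show "u \<in> ?N"
    using u(1) N.subset lift.G.rcos_self[OF u(1) N.subgroup_axioms] lift.G.coset_mult_one by blast
qed

end

text \<open>Makes the order bound for abstract groups applicable to the presented group itself, with
  the cosets of the free generators as generators.\<close>

lemma presented_group_pword_val:
  assumes words: "\<And>r. r \<in> R \<Longrightarrow> set_pword r \<subseteq> X" and r: "r \<in> R"
  shows "pword_val (presented_group X R) (\<lambda>x. relators X R #>\<^bsub>free_group X\<^esub> free_gen x) r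
      = \<one>\<^bsub>presented_group X R\<^esub>"
proof -
  let ?N = "relators X R" let ?F = "free_group X"
  interpret N: normal ?N ?F by (rule normal_relators[OF words])
  have "?N #>\<^bsub>?F\<^esub> pword_val ?F free_gen r
      = pword_val (?F Mod ?N) ((\<lambda>u. ?N #>\<^bsub>?F\<^esub> u) \<circ> free_gen) r"
    by (rule hom_pword_val[OF group_free_group N.factorgroup_is_group N.r_coset_hom_Mod])
       (use words[OF r] in auto)
  also have "?N #>\<^bsub>?F\<^esub> pword_val ?F free_gen r = ?N"
    using relator_mem[OF words r] N.rcos_const[OF group_free_group] by simp
  finally show ?thesis by (simp add: presented_group_eq FactGroup_def o_def)
qed

lemma presented_group_generated:
  assumes words: "\<And>r. r \<in> R \<Longrightarrow> set_pword r \<subseteq> X"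
  shows "generate (presented_group X R) ((\<lambda>x. relators X R #>\<^bsub>free_group X\<^esub> free_gen x) ` X)
      = carrier (presented_group X R)"
proof -
  let ?N = "relators X R" let ?F = "free_group X"
  interpret N: normal ?N ?F by (rule normal_relators[OF words])
  interpret h: group_hom ?F "?F Mod ?N" "\<lambda>u. ?N #>\<^bsub>?F\<^esub> u"
    by (intro group_hom.intro group_hom_axioms.intro N.factorgroup_is_group group_free_group
        N.r_coset_hom_Mod)
  have P: "carrier (?F Mod ?N) = (\<lambda>u. ?N #>\<^bsub>?F\<^esub> u) ` carrier ?F"
    by (auto simp: FactGroup_def RCOSETS_def)
  have "free_gen ` X \<subseteq> carrier ?F" by auto
  then have "generate (?F Mod ?N) ((\<lambda>u. ?N #>\<^bsub>?F\<^esub> u) ` free_gen ` X)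
      = (\<lambda>u. ?N #>\<^bsub>?F\<^esub> u) ` generate ?F (free_gen ` X)"
    by (rule h.generate_img)
  then show ?thesis unfolding presented_group_eq P free_group_generated image_image .
qed

lemma (in group_hom) hom_in_image_subgroup_conj:
  assumes "N \<lhd> G" "g \<in> carrier G" "n \<in> N"
  shows "h g \<otimes>\<^bsub>H\<^esub> h n \<otimes>\<^bsub>H\<^esub> inv\<^bsub>H\<^esub> h g \<in> h ` N"
proof -
  interpret N: normal N G by fact
  have "h g \<otimes>\<^bsub>H\<^esub> h n \<otimes>\<^bsub>H\<^esub> inv\<^bsub>H\<^esub> h g = h (g \<otimes> n \<otimes> inv g)"
    using assms(2) N.mem_carrier[OF assms(3)] by simp
  then show ?thesis using N.inv_op_closed2[OF assms(2,3)] by simp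
qed

text \<open>The image of \<open>relators X (insert w R)\<close> in \<open>A \<times> T\<close> contains \<open>1 \<times> T\<close>, hence every element of the
  kernel of the map to \<open>A\<close> is congruent modulo these relators to an element of the kernel of the map
  to \<open>A \<times> T\<close>.\<close>

lemma is_presentation_DirProd_fst:
  assumes A: "group A" and T: "group T"
    and data: "presentation_data (A \<times>\<times> T) f X R"
    and kernel: "kernel (free_group X) (A \<times>\<times> T) (free_lift (A \<times>\<times> T) f) \<subseteq> relators X R"
    and w: "set_pword w \<subseteq> X" "pword_val (A \<times>\<times> T) f w = (\<one>\<^bsub>A\<^esub>, t)"
    and t: "t \<in> carrier T" "normal_closure T {t} = carrier T"
  shows "is_presentation A X (insert w R)"
proof -
  interpret A: group A by (rule A)
  interpret T: group T by (rule T)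
  interpret D: presentation_data "A \<times>\<times> T" f X R by (rule data)
  let ?F = "free_group X" and ?h = "free_lift (A \<times>\<times> T) f"
  let ?N = "relators X (insert w R)"
  have fst_hom: "fst \<in> hom (A \<times>\<times> T) A" by (auto simp: hom_def DirProd_def)
  interpret fst: group_hom "A \<times>\<times> T" A fst
    using A D.group_K fst_hom by (simp add: group_hom_def group_hom_axioms_def)
  have f_AT: "fst (f x) \<in> carrier A" if "x \<in> X" for x
    using D.f_closed that by (auto simp: image_subset_iff mem_Times_iff)
  have words: "set_pword r \<subseteq> X" if "r \<in> insert w R" for r using w D.words that by auto
  define f' where "f' x = fst (f x)" for x
  have f': "f' = fst \<circ> f" by (auto simp: f'_def)
  interpret E: presentation_data A "f'" X "insert w R"
  proof
    show "pword_val A f' r = \<one>\<^bsub>A\<^esub>" if "r \<in> insert w R" for r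
    proof -
      have "pword_val A f' r = fst (pword_val (A \<times>\<times> T) f r)"
        unfolding f' by (rule hom_pword_val[OF D.group_K A fst_hom, symmetric])
           (use D.f_closed words[OF that] in blast)
      then show ?thesis using that w D.holds by auto
    qed
    have "generate A (fst ` f ` X) = fst ` carrier (A \<times>\<times> T)"
      using fst.generate_img[OF D.f_closed] D.f_gen by simp
    then show "generate A (f' ` X) = carrier A"
      using T.one_closed by (force simp: f' image_comp)
  qed (use A D.finite_X D.finite_R words f_AT in \<open>auto simp: f'_def\<close>)
  interpret N: normal ?N ?F by (rule normal_relators[OF words])
  \<comment> \<open>Both sides are homomorphisms that agree on the free generators.\<close>
  have lift_fst: "free_lift A f' u = fst (?h u)" if "u \<in> carrier ?F" for u
  proof -
    have u: "u \<in> generate ?F (free_gen ` X)" using that by (simp add: free_group_generated)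
    have gc: "v \<in> carrier ?F" if "v \<in> generate ?F (free_gen ` X)" for v
      using that by (simp add: free_group_generated)
    show ?thesis using u
    proof (induction rule: generate.induct)
      case one
      show ?case by (simp only: E.lift.hom_one D.lift.hom_one fst.hom_one)
    next
      case (incl v)
      then obtain x where x: "x \<in> X" "v = free_gen x" by blast
      show ?case unfolding x(2) D.lift_gen[OF x(1)] E.lift_gen[OF x(1)] by (rule f'_def)
    next
      case (inv v)
      then obtain x where x: "x \<in> X" "v = free_gen x" by blast
      have xc: "free_gen x \<in> carrier ?F" and fx: "f x \<in> carrier (A \<times>\<times> T)"
        using x(1) D.f_closed by (simp, blast)
      show ?case
        unfolding x(2) E.lift.hom_inv[OF xc] D.lift.hom_inv[OF xc] D.lift_gen[OF x(1)]
          E.lift_gen[OF x(1)] fst.hom_inv[OF fx] unfolding f'_def by (rule refl)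
    next
      case (eng u v)
      then show ?case using gc[of u] gc[of v] fst.hom_mult[of "?h u" "?h v"]
        by (simp only: E.lift.hom_mult D.lift.hom_mult D.lift.hom_closed)
    qed
  qed
  have sub: "subgroup (?h ` ?N) (A \<times>\<times> T)"
    by (rule D.lift.subgroup_img_is_subgroup) (rule N.subgroup_axioms)
  have T_le: "(\<one>\<^bsub>A\<^esub>, s) \<in> ?h ` ?N" if "s \<in> carrier T" for s
  proof -
    \<comment> \<open>The relator \<open>w\<close> has image (1, t). Since \<open>?h\<close> is
      onto, conjugating \<open>w\<close> by a preimage of (1, g) gives any desired conjugate of
      \<open>t\<close> in the second factor.\<close>
    have conj: "(\<one>\<^bsub>A\<^esub>, g \<otimes>\<^bsub>T\<^esub> t \<otimes>\<^bsub>T\<^esub> inv\<^bsub>T\<^esub> g) \<in> ?h ` ?N" if "g \<in> carrier T" for g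
    proof -
      have "(\<one>\<^bsub>A\<^esub>, g) \<in> carrier (A \<times>\<times> T)" using that by simp
      then obtain u where u: "u \<in> carrier ?F" "?h u = (\<one>\<^bsub>A\<^esub>, g)"
        unfolding D.lift_surj[symmetric] by (metis imageE)
      have "pword_val ?F free_gen w \<in> ?N" by (rule relator_mem[OF words]) auto
      from D.lift.hom_in_image_subgroup_conj[OF N.normal_axioms u(1) this]
      show ?thesis using that t u w by (simp add: D.lift_pword_val)
    qed
    have s: "s \<in> generate T {g \<otimes>\<^bsub>T\<^esub> s \<otimes>\<^bsub>T\<^esub> inv\<^bsub>T\<^esub> g |g s. g \<in> carrier T \<and> s \<in> {t}}"
      using that t by (simp add: normal_closure_def)
    have S: "{g \<otimes>\<^bsub>T\<^esub> s \<otimes>\<^bsub>T\<^esub> inv\<^bsub>T\<^esub> g |g s. g \<in> carrier T \<and> s \<in> {t}} \<subseteq> carrier T"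
      using t by auto
    show ?thesis
      using s
    proof (induction rule: generate.induct)
      case one
      then show ?case using subgroup.one_closed[OF sub] by simp
    next
      case (incl v)
      then show ?case using conj by auto
    next
      case (inv v)
      then obtain g where g: "g \<in> carrier T" "v = g \<otimes>\<^bsub>T\<^esub> t \<otimes>\<^bsub>T\<^esub> inv\<^bsub>T\<^esub> g" by auto
      then have "v \<in> carrier T" using t by simp
      then show ?case
        using subgroup.m_inv_closed[OF sub conj[OF g(1)]] g by (simp add: inv_DirProd A T)
    next
      case (eng u v)
      show ?case using subgroup.m_closed[OF sub eng.IH] by simp
    qed
  qed
  show ?thesis
  proof (rule E.is_presentation_if_kernel_le, rule subsetI)
    fix u assume "u \<in> kernel ?F A (free_lift A f')"
    then have u: "u \<in> carrier ?F" "free_lift A f' u = \<one>\<^bsub>A\<^esub>" by (simp_all only: kernel_def mem_Collect_eq)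
    define s where "s = snd (?h u)"
    have "?h u \<in> carrier (A \<times>\<times> T)" using u(1) by (rule D.lift.hom_closed)
    then have s: "s \<in> carrier T" "?h u = (\<one>\<^bsub>A\<^esub>, s)"
      using u(2) lift_fst[OF u(1)] by (simp_all add: s_def mem_Times_iff prod_eq_iff)
    then obtain v where v: "?h u = ?h v" "v \<in> ?N" using T_le[OF s(1)] by (metis imageE)
    have vF: "v \<in> carrier ?F" using v(2) by (rule N.mem_carrier)
    have "u \<otimes>\<^bsub>?F\<^esub> inv\<^bsub>?F\<^esub> v \<in> kernel ?F (A \<times>\<times> T) ?h"
      using u(1) vF v(1) D.lift.hom_closed[OF vF]
      by (simp only: kernel_def mem_Collect_eq D.lift.hom_mult D.lift.hom_inv D.lift.H.r_inv
          D.lift.G.m_closed D.lift.G.inv_closed simp_thms)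
    then have "u \<otimes>\<^bsub>?F\<^esub> inv\<^bsub>?F\<^esub> v \<in> ?N"
      using kernel relators_mono[OF words subset_insertI] by (meson subsetD)
    then have "u \<otimes>\<^bsub>?F\<^esub> inv\<^bsub>?F\<^esub> v \<otimes>\<^bsub>?F\<^esub> v \<in> ?N" using v(2) by (rule N.m_closed)
    then show "u \<in> ?N" using u vF by (simp add: D.lift.G.m_assoc)
  qed
qed


section \<open>Generators of the alternating group\<close>

text \<open>This is the cycle \<open>i \<mapsto> n + 1 \<mapsto> n + 2 \<mapsto> i\<close>.\<close>

definition tri :: "nat \<Rightarrow> nat \<Rightarrow> nat \<Rightarrow> nat" where
  "tri n i = transpose i (n + 1) \<circ> transpose (n + 1) (n + 2)"

lemma tri_permutes: "i \<in> {1..n} \<Longrightarrow> tri n i permutes {1..n + 2}"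
  unfolding tri_def by (intro permutes_compose permutes_swap_id) auto

lemma tri_closed: "i \<in> {1..n} \<Longrightarrow> tri n i \<in> carrier (alt_group (n + 2))"
  using tri_permutes[of i n]
  by (simp add: alt_group_carrier tri_def evenperm_comp permutation_swap_id evenperm_swap)

lemma tri_tri: "i \<in> {1..n} \<Longrightarrow> tri n i \<circ> tri n i = transpose (n + 1) (n + 2) \<circ> transpose i (n + 1)"
  by (auto simp: tri_def fun_eq_iff transpose_def)

lemma tri_cube: "i \<in> {1..n} \<Longrightarrow> tri n i \<circ> tri n i \<circ> tri n i = id"
  by (auto simp: tri_def fun_eq_iff transpose_def)

lemma tri_mult_tri:
  assumes "i \<in> {1..n}" "j \<in> {1..n}" "i \<noteq> j"
  shows "tri n i \<circ> tri n j = transpose i (n + 1) \<circ> transpose j (n + 2)"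
  using assms by (auto simp: tri_def fun_eq_iff transpose_def)

lemma tri_mult_tri_square:
  assumes "i \<in> {1..n}" "j \<in> {1..n}" "i \<noteq> j"
  shows "(tri n i \<circ> tri n j) \<circ> (tri n i \<circ> tri n j) = id"
  unfolding tri_mult_tri[OF assms] using assms by (auto simp: fun_eq_iff transpose_def)

text \<open>A permutation of the first \<open>n\<close> points fixes the other two, so it only
  relabels the first point of the cycle. Thus affine maps permute the Carmichael generators as they
  permute the points.\<close>

lemma tri_conj:
  assumes "s permutes {1..n}"
  shows "s \<circ> tri n i = tri n (s i) \<circ> s"
proof -
  have "s (n + 1) = n + 1" "s (n + 2) = n + 2"
    using assms by (simp_all add: permutes_not_in)
  moreover have "s \<circ> transpose a b = transpose (s a) (s b) \<circ> s" for a b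
    using permutes_inj[OF assms] by (auto simp: fun_eq_iff transpose_def inj_eq)
  ultimately show ?thesis unfolding tri_def by (metis comp_assoc)
qed

text \<open>With \<open>?t\<close> the transposition of the two common points, \<open>H\<close> and
  its translate by \<open>?t\<close> together are stable under the transpositions through
  \<open>n + 1\<close>, hence contain every permutation. As \<open>?t\<close> is odd, the even
  permutations all lie in \<open>H\<close>.\<close>

lemma alt_group_subgroup_tri:
  assumes H: "subgroup H (alt_group (n + 2))" and tri: "\<And>i. i \<in> {1..n} \<Longrightarrow> tri n i \<in> H"
  shows "H = carrier (alt_group (n + 2))"
proof
  show HA: "H \<subseteq> carrier (alt_group (n + 2))" using H by (rule subgroup.subset)
  let ?t = "transpose (n + 1) (n + 2)"
  have tt: "?t \<circ> ?t = id" by simp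
  have comp: "f \<circ> g \<in> H" if "f \<in> H" "g \<in> H" for f g
    using subgroup.m_closed[OF H that] by (simp add: alt_group_mult)
  define B where "B = {s. s \<in> H \<or> ?t \<circ> s \<in> H}"
  have B_t: "?t \<circ> s \<in> B" if "s \<in> B" for s
    using that by (auto simp: B_def comp_assoc[symmetric])
  have B_i: "transpose i (n + 1) \<circ> s \<in> B" if i: "i \<in> {1..n}" and s: "s \<in> B" for i s
  proof -
    \<comment> \<open>The two products of \<open>transpose i (n + 1)\<close> with \<open>?t\<close>
      are \<open>tri n i\<close> and its inverse, so multiplication by this transposition exchanges
      the two halves of \<open>B\<close>.\<close>
    have "transpose i (n + 1) \<circ> s = tri n i \<circ> (?t \<circ> s)"
      by (simp add: tri_def comp_assoc) (simp add: comp_assoc[symmetric])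
    moreover have "?t \<circ> (transpose i (n + 1) \<circ> s) = (tri n i \<circ> tri n i) \<circ> s"
      using tri_tri[OF i] by (simp add: comp_assoc)
    ultimately show ?thesis using s comp[OF tri[OF i]] comp[OF comp[OF tri[OF i] tri[OF i]]]
      unfolding B_def by auto
  qed
  have B_a: "transpose a (n + 1) \<circ> s \<in> B" if "a \<in> {1..n + 2}" "s \<in> B" for a s
  proof -
    have "a \<in> {1..n} \<or> a = n + 1 \<or> a = n + 2" using that(1) by auto
    then consider "a \<in> {1..n}" | "a = n + 1" | "a = n + 2" by blast
    then show ?thesis
    proof cases
      case 3
      then show ?thesis using B_t[OF that(2)] by (simp add: transpose_commute)
    qed (use B_i[OF _ that(2)] that(2) in auto)
  qed
  have all: "s \<in> B" if "s permutes {1..n + 2}" for s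
    using that finite_atLeastAtMost[of 1 "n + 2"]
  proof (induction rule: permutes_induct)
    case id
    show ?case using subgroup.one_closed[OF H] unfolding B_def alt_group_one by blast
  next
    case (swap a b s)
    show ?case
    proof (cases "a = n + 1 \<or> b = n + 1")
      case True
      then show ?thesis using B_a swap.hyps swap.IH by (metis transpose_commute)
    next
      case False
      then have "transpose a b = transpose a (n + 1) \<circ> transpose b (n + 1) \<circ> transpose a (n + 1)"
        using swap.hyps(3) by (auto simp: fun_eq_iff transpose_def)
      then show ?thesis using B_a[OF swap.hyps(1) B_a[OF swap.hyps(2) B_a[OF swap.hyps(1) swap.IH]]]
        by (simp only: comp_assoc)
    qed
  qed
  show "carrier (alt_group (n + 2)) \<subseteq> H"
  proof
    fix s assume s: "s \<in> carrier (alt_group (n + 2))"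
    then have "s \<in> B" using all alt_group_carrier by blast
    moreover have "\<not> evenperm (?t \<circ> s)"
      using s alt_group_carrier'[OF s]
      by (simp add: alt_group_carrier evenperm_comp permutation_swap_id evenperm_swap)
    then have "?t \<circ> s \<notin> H" using HA by (auto simp: alt_group_carrier)
    ultimately show "s \<in> H" by (simp add: B_def)
  qed
qed


section \<open>Affine maps with square multiplier\<close>

locale prime_11_mod_12 =
  fixes p q m h :: nat
  assumes prime_p: "prime p" and p_eq: "p = 2 * q + 1" and q3: "q + 1 = 3 * m" and odd_q: "odd q"
    and primroot: "residue_primroot p h"
begin

text \<open>A generator of the group of nonzero squares modulo \<open>p\<close>, of order
  \<open>q\<close>.\<close>

definition r :: nat where "r = h ^ 2"

lemma q_pos: "q > 0" using odd_q by (cases q) auto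
lemma q_gt_1: "q > 1" using q3 q_pos by presburger
lemma p_pos: "p > 0" and p_gt_2: "p > 2" using p_eq q_gt_1 by auto

lemma h_pow_cong_1: "[h ^ k = 1] (mod p) \<longleftrightarrow> 2 * q dvd k"
  using primroot ord_divides[of h k p] totient_prime[OF prime_p] p_eq
  by (simp add: residue_primroot_def)

lemma r_pow_cong_1: "[r ^ k = 1] (mod p) \<longleftrightarrow> q dvd k"
  using h_pow_cong_1[of "2 * k"] by (simp add: r_def power_mult[symmetric])

lemma int_cong_pow: "[int r ^ k = 1] (mod int p) \<longleftrightarrow> q dvd k"
  using r_pow_cong_1[of k] cong_int_iff[of "r ^ k" 1 p] by simp

lemma r_pow_q: "[int r ^ q = 1] (mod int p)"
  by (simp add: int_cong_pow)

text \<open>Powers of \<open>r\<close> have \<open>q\<close>-th power 1, but -1 does not, because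
  \<open>q\<close> is odd.\<close>

lemma not_r_pow_cong_minus_1: "\<not> [int r ^ k = -1] (mod int p)"
proof
  assume "[int r ^ k = -1] (mod int p)"
  then have "[(int r ^ k) ^ q = (-1) ^ q] (mod int p)" by (rule cong_pow)
  moreover have "[(int r ^ k) ^ q = 1] (mod int p)"
    using int_cong_pow[of "k * q"] by (simp add: power_mult)
  ultimately have "[1 = - 1] (mod int p)" using odd_q cong_trans cong_sym
    by (metis power_minus_odd power_one)
  then have "int p dvd 2" by (simp add: cong_iff_dvd_diff)
  then show False using p_gt_2 zdvd_imp_le[of "int p" 2] by simp
qed

text \<open>This is a square root of 1 in a field, and it is not 1 since \<open>h\<close> has order
  2q.\<close>

lemma h_pow_q: "[int h ^ q = -1] (mod int p)"
proof -
  have "[h ^ (2 * q) = 1] (mod p)" using h_pow_cong_1 by simp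
  then have "int p dvd int h ^ (2 * q) - 1"
    using cong_int_iff[of "h ^ (2 * q)" 1 p] by (simp add: cong_iff_dvd_diff)
  also have "int h ^ (2 * q) - 1 = (int h ^ q - 1) * (int h ^ q + 1)"
    by (simp add: algebra_simps power_mult power2_eq_square flip: power_mult_distrib power_add mult_2)
  finally have "int p dvd int h ^ q - 1 \<or> int p dvd int h ^ q + 1"
    using prime_p by (simp add: prime_dvd_mult_iff)
  moreover have "\<not> 2 * q dvd q" using q_pos by (auto dest: dvd_imp_le)
  then have "\<not> [h ^ q = 1] (mod p)" using h_pow_cong_1 by simp
  then have "\<not> int p dvd int h ^ q - 1"
    using cong_int_iff[of "h ^ q" 1 p] by (simp add: cong_iff_dvd_diff)
  ultimately show ?thesis by (simp add: cong_iff_dvd_diff)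
qed

text \<open>Let v be \<open>h ^ i\<close> modulo \<open>p\<close>. For even i it is a power of
  \<open>r\<close>; for odd i the factor \<open>h ^ q\<close>, which is -1, makes the exponent
  even.\<close>

lemma pm_r_pow_cong:
  assumes "\<not> int p dvd v"
  shows "\<exists>k. [v = int r ^ k] (mod int p) \<or> [v = - (int r ^ k)] (mod int p)"
proof -
  define w where "w = nat (v mod int p)"
  have w: "int w = v mod int p" using p_pos by (simp add: w_def)
  have "w < p" using p_pos by (simp add: w_def nat_less_iff)
  moreover have "w > 0"
  proof (rule ccontr)
    assume "\<not> w > 0"
    then show False using w assms by (simp add: dvd_eq_mod_eq_0)
  qed
  ultimately have "w \<in> totatives p" using totatives_prime[OF prime_p] by simp
  then have "w \<in> (\<lambda>i. h ^ i mod p) ` {..<totient p}"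
    using bij_betw_imp_surj_on[OF residue_primroot_is_generator[OF prime_gt_1_nat[OF prime_p] primroot]]
    by (simp only:)
  then obtain i where "w = h ^ i mod p" by blast
  then have "v mod int p = int h ^ i mod int p" using w by (simp add: zmod_int)
  then have vi: "[v = int h ^ i] (mod int p)" by (simp add: cong_def)
  show ?thesis
  proof (cases "even i")
    case True
    then obtain k where "i = 2 * k" by blast
    then have "[v = int r ^ k] (mod int p)" using vi by (simp add: r_def power_mult)
    then show ?thesis by blast
  next
    case False
    with odd_q have "even (i + q)" by simp
    then obtain k where k: "i + q = 2 * k" by blast
    have "int r ^ k = int h ^ i * int h ^ q"
      using k by (simp add: r_def flip: power_mult power_add)
    moreover have "[int h ^ i * int h ^ q = v * (-1)] (mod int p)"
      by (rule cong_mult[OF cong_sym[OF vi] h_pow_q])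
    ultimately have "[- v = int r ^ k] (mod int p)" by (simp add: cong_sym)
    then have "[v = - (int r ^ k)] (mod int p)"
      using cong_minus_minus_iff[of v "- (int r ^ k)" "int p"] by simp
    then show ?thesis by blast
  qed
qed

text \<open>Supplies the 2-homogeneity assumed in \<open>affine_carmichael\<close>: up to sign, the
  difference of two points is a power of \<open>r\<close>.\<close>

lemma pm_r_pow_diff:
  fixes i j :: nat
  assumes "i < p" "j < p" "i \<noteq> j"
  shows "\<exists>k. [j = i + r ^ k] (mod p) \<or> [i = j + r ^ k] (mod p)"
proof -
  have "\<not> int p dvd int j - int i"
  proof
    assume "int p dvd int j - int i"
    then have "[j = i] (mod p)" using cong_int_iff[of j i p] by (simp add: cong_iff_dvd_diff)
    then show False using assms cong_less_modulus_unique_nat by blast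
  qed
  then obtain k where "[int j - int i = int r ^ k] (mod int p) \<or>
      [int j - int i = - (int r ^ k)] (mod int p)"
    using pm_r_pow_cong by blast
  then have "[int j = int (i + r ^ k)] (mod int p) \<or> [int i = int (j + r ^ k)] (mod int p)"
  proof
    assume "[int j - int i = int r ^ k] (mod int p)"
    then show ?thesis by (simp add: cong_iff_dvd_diff algebra_simps)
  next
    assume "[int j - int i = - (int r ^ k)] (mod int p)"
    then have "int p dvd - (int j - int i + int r ^ k)" by (simp only: cong_iff_dvd_diff dvd_minus_iff diff_minus_eq_add)
    then show ?thesis by (simp add: cong_iff_dvd_diff algebra_simps)
  qed
  then show ?thesis by (simp only: cong_int_iff) blast
qed

lemma coprime_r [simp]: "coprime r p"
proof -
  have "coprime h p" using primroot by (simp add: residue_primroot_def coprime_commute)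
  then show ?thesis by (simp add: r_def)
qed

text \<open>The solution is r / (1 - r) modulo \<open>p\<close>; here r is not 1 because
  \<open>q > 1\<close>. The bound \<open>t < p\<close> keeps the relators short.\<close>

lemma ex_t: "\<exists>t<p. [r * (t + 1) = t] (mod p)"
proof -
  have "\<not> [int r = 1] (mod int p)" using int_cong_pow[of 1] q_gt_1 by simp
  then have "coprime (1 - int r) (int p)"
    using prime_p by (metis cong_iff_dvd_diff cong_sym coprime_commute prime_imp_coprime prime_nat_int_transfer)
  then obtain i where i: "[(1 - int r) * i = 1] (mod int p)" using cong_solve_coprime_int by blast
  define t where "t = nat ((int r * i) mod int p)"
  have t: "int t = (int r * i) mod int p" using p_pos by (simp add: t_def)
  then have "[int t = int r * i] (mod int p)" by (simp add: cong_def)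
  then have "[(1 - int r) * int t = (1 - int r) * (int r * i)] (mod int p)"
    by (intro cong_mult cong_refl)
  also have "(1 - int r) * (int r * i) = int r * ((1 - int r) * i)" by simp
  also have "[\<dots> = int r * 1] (mod int p)" using i by (intro cong_mult cong_refl)
  finally have "int p dvd (1 - int r) * int t - int r" by (simp add: cong_iff_dvd_diff)
  then have "int p dvd - ((1 - int r) * int t - int r)" by (simp only: dvd_minus_iff)
  then have "[int (r * (t + 1)) = int t] (mod int p)" by (simp add: cong_iff_dvd_diff algebra_simps)
  moreover have "t < p" using p_pos by (simp add: t_def nat_less_iff)
  ultimately show ?thesis by (auto simp only: cong_int_iff)
qed

definition t :: nat where "t = (SOME t. t < p \<and> [r * (t + 1) = t] (mod p))"

lemma t_less: "t < p" and t_cong: "[r * (t + 1) = t] (mod p)"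
  using someI_ex[OF ex_t] by (simp_all add: t_def)

lemma t_cong_int: "[int r * (int t + 1) = int t] (mod int p)"
  using t_cong cong_int_iff[of "r * (t + 1)" t p] by (simp add: algebra_simps)

section \<open>Affine maps modulo \<open>p\<close> and the group \<open>T\<close>\<close>

definition aff :: "int \<Rightarrow> int \<Rightarrow> int \<Rightarrow> int" where
  "aff a b = (\<lambda>v\<in>{0..int p - 1}. (a * v + b) mod int p)"

abbreviation "S \<equiv> {0..int p - 1}"

abbreviation "T \<equiv> AGL1_sq (residue_ring (int p))"

lemma mod_S [simp]: "v mod int p \<in> S"
  using p_pos by simp

lemma aff_apply: "v \<in> S \<Longrightarrow> aff a b v = (a * v + b) mod int p"
  by (simp add: aff_def)

lemma aff_cong:
  assumes "[a = a'] (mod int p)" "[b = b'] (mod int p)"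
  shows "aff a b = aff a' b'"
proof
  fix v
  have "[a * v + b = a' * v + b'] (mod int p)" using assms by (intro cong_add cong_mult cong_refl)
  then show "aff a b v = aff a' b' v" by (simp add: aff_def cong_def)
qed

lemma S_cong_eq: "v \<in> S \<Longrightarrow> w \<in> S \<Longrightarrow> [v = w] (mod int p) \<Longrightarrow> v = w"
  by (simp add: cong_def)

lemma aff_eq_imp_cong:
  assumes "aff a b = aff a' b'"
  shows "[a = a'] (mod int p)" "[b = b'] (mod int p)"
proof -
  have 0: "(0::int) \<in> S" "(1::int) \<in> S" using p_gt_2 by auto
  have "aff a b 0 = aff a' b' 0" using assms by simp
  then show b: "[b = b'] (mod int p)" using aff_apply[OF 0(1)] by (simp add: cong_def)
  have "aff a b 1 = aff a' b' 1" using assms by simp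
  then have "[a + b = a' + b'] (mod int p)" using aff_apply[OF 0(2)] by (simp add: cong_def)
  then show "[a = a'] (mod int p)" using b cong_diff[of "a + b" "a' + b'" "int p" b b'] by simp
qed

lemma aff_Bij:
  assumes "coprime a (int p)"
  shows "aff a b \<in> Bij S"
proof -
  have "inj_on (aff a b) S"
  proof (rule inj_onI)
    fix v w assume v: "v \<in> S" "w \<in> S" "aff a b v = aff a b w"
    then have "[a * v + b = a * w + b] (mod int p)" by (simp add: aff_apply cong_def)
    then have "[a * v = a * w] (mod int p)" using cong_add_rcancel by blast
    then have "[v = w] (mod int p)" using assms cong_mult_lcancel by blast
    then show "v = w" using v by (intro S_cong_eq)
  qed
  moreover have "aff a b ` S \<subseteq> S" using p_pos by (auto simp: aff_apply)
  ultimately have "bij_betw (aff a b) S S"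
    by (simp add: bij_betw_def endo_inj_surj)
  then show ?thesis by (auto simp: Bij_def aff_def)
qed

lemma compose_aff: "compose S (aff a b) (aff a' b') = aff (a * a') (a * b' + b)"
proof
  fix v
  show "compose S (aff a b) (aff a' b') v = aff (a * a') (a * b' + b) v"
  proof (cases "v \<in> S")
    case True
    have "compose S (aff a b) (aff a' b') v = aff a b ((a' * v + b') mod int p)"
      using True by (simp add: compose_def aff_apply)
    also have "\<dots> = (a * ((a' * v + b') mod int p) + b) mod int p" by (rule aff_apply) (rule mod_S)
    also have "\<dots> = (a * (a' * v + b') + b) mod int p" by (metis mod_add_left_eq mod_mult_right_eq)
    also have "\<dots> = (a * a' * v + (a * b' + b)) mod int p" by (simp add: algebra_simps)
    finally show ?thesis using True by (simp only: aff_apply)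
  next
    case False
    then show ?thesis by (simp only: compose_def aff_def restrict_apply if_False)
  qed
qed

lemma T_mult: "f \<in> Bij S \<Longrightarrow> g \<in> Bij S \<Longrightarrow> f \<otimes>\<^bsub>T\<^esub> g = compose S f g"
  by (simp add: AGL1_sq_def AGL1_def residue_ring_def BijGroup_def)

lemma aff_mult:
  assumes "coprime a (int p)" "coprime a' (int p)"
  shows "aff a b \<otimes>\<^bsub>T\<^esub> aff a' b' = aff (a * a') (a * b' + b)"
  using assms by (simp add: T_mult aff_Bij compose_aff)

lemma T_one: "\<one>\<^bsub>T\<^esub> = aff 1 0"
  by (auto simp: AGL1_sq_def AGL1_def residue_ring_def BijGroup_def aff_def fun_eq_iff)

text \<open>Square multipliers become powers of \<open>r\<close>: a unit is plus or minus a power of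
  \<open>r\<close>, so its square is again one, and conversely \<open>r ^ j\<close> is the square of
  \<open>h ^ j\<close>.\<close>

lemma T_carrier_eq: "carrier T = {aff (int r ^ j) b | j b. True}"
proof -
  let ?F = "residue_ring (int p)"
  have "carrier T = {\<lambda>x\<in>S. ((a * x) mod int p + b) mod int p | a b.
      a \<in> {(c * c) mod int p | c. c \<in> S - {0}} \<and> b \<in> S}"
    by (simp add: AGL1_sq_def residue_ring_def)
  also have "\<dots> = {aff a b | a b. a \<in> {(c * c) mod int p | c. c \<in> S - {0}} \<and> b \<in> S}"
    unfolding aff_def by (simp only: mod_add_left_eq)
  also have "\<dots> = {aff ((c * c) mod int p) b | c b. c \<in> S - {0} \<and> b \<in> S}"
    by blast
  finally have 1: "carrier T = {aff ((c * c) mod int p) b | c b. c \<in> S - {0} \<and> b \<in> S}" .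
  show ?thesis unfolding 1
  proof (intro equalityI subsetI)
    fix f assume "f \<in> {aff ((c * c) mod int p) b | c b. c \<in> S - {0} \<and> b \<in> S}"
    then obtain c b where f: "f = aff ((c * c) mod int p) b" and c: "c \<in> S - {0}" by blast
    have "\<not> int p dvd c" using c zdvd_imp_le[of "int p" c] by auto
    then obtain k where k: "[c = int r ^ k] (mod int p) \<or> [c = - (int r ^ k)] (mod int p)"
      using pm_r_pow_cong by blast
    then have "[c * c = int r ^ (2 * k)] (mod int p)"
    proof
      assume "[c = int r ^ k] (mod int p)"
      from cong_mult[OF this this] show ?thesis by (simp add: mult_2 power_add)
    next
      assume "[c = - (int r ^ k)] (mod int p)"
      from cong_mult[OF this this] show ?thesis by (simp add: mult_2 power_add)
    qed
    then have "f = aff (int r ^ (2 * k)) b" unfolding f by (intro aff_cong) (simp_all add: cong_def)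
    then show "f \<in> {aff (int r ^ j) b | j b. True}" by blast
  next
    fix f assume "f \<in> {aff (int r ^ j) b | j b. True}"
    then obtain j b where f: "f = aff (int r ^ j) b" by blast
    define c where "c = int h ^ j mod int p"
    have "coprime (int h ^ j) (int p)"
      using primroot by (simp add: residue_primroot_def coprime_commute)
    then have "c \<noteq> 0"
      using coprime_common_divisor[of "int h ^ j" "int p" "int p"] p_gt_2
      by (auto simp: c_def dvd_eq_mod_eq_0)
    moreover have "[(c * c) mod int p = int r ^ j] (mod int p)"
      by (simp add: c_def cong_def mod_simps r_def power2_eq_square power_mult_distrib)
    then have "f = aff ((c * c) mod int p) (b mod int p)"
      unfolding f by (intro aff_cong) (simp_all add: cong_sym_eq cong_def)
    moreover have "c \<in> S" "b mod int p \<in> S" unfolding c_def by (rule mod_S)+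
    ultimately show "f \<in> {aff ((c * c) mod int p) b | c b. c \<in> S - {0} \<and> b \<in> S}" by blast
  qed
qed

lemma aff_closed [simp]: "aff (int r ^ j) b \<in> carrier T"
  unfolding T_carrier_eq by blast

lemma group_T: "group T"
proof -
  interpret B: group "BijGroup S" by (rule group_BijGroup)
  have sub: "subgroup (carrier T) (BijGroup S)"
  proof (rule B.subgroupI)
    show "carrier T \<subseteq> carrier (BijGroup S)"
      unfolding T_carrier_eq by (auto simp: BijGroup_def aff_Bij)
    show "carrier T \<noteq> {}" unfolding T_carrier_eq by blast
    have mult: "f \<otimes>\<^bsub>BijGroup S\<^esub> g = f \<otimes>\<^bsub>T\<^esub> g" for f g
      by (simp add: AGL1_sq_def AGL1_def residue_ring_def)
    fix f assume "f \<in> carrier T"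
    then obtain j b where f: "f = aff (int r ^ j) b" unfolding T_carrier_eq by blast
    have cl: "aff (int r ^ j) b \<in> carrier (BijGroup S)" for j b by (auto simp: BijGroup_def aff_Bij)
    {
      fix g assume "g \<in> carrier T"
      then obtain j' b' where g: "g = aff (int r ^ j') b'" unfolding T_carrier_eq by blast
      show "f \<otimes>\<^bsub>BijGroup S\<^esub> g \<in> carrier T"
        unfolding f g mult by (simp add: aff_mult flip: power_add)
    }
    \<comment> \<open>An inverse of \<open>r ^ j\<close> modulo \<open>p\<close>, because
      \<open>r ^ (j * q)\<close> is congruent to 1.\<close>
    define a where "a = int r ^ (j * (q - 1))"
    have "aff a (- (a * b)) \<otimes>\<^bsub>T\<^esub> aff (int r ^ j) b = aff (a * int r ^ j) 0"
      by (simp add: aff_mult a_def)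
    also have "\<dots> = aff 1 0"
    proof (rule aff_cong)
      have "a * int r ^ j = int r ^ (j * (q - 1) + j)" unfolding a_def by (simp only: power_add)
      also have "j * (q - 1) + j = j * q" using q_pos by (cases q) simp_all
      finally show "[a * int r ^ j = 1] (mod int p)" using int_cong_pow[of "j * q"] by simp
    qed simp
    also have "aff 1 0 = \<one>\<^bsub>BijGroup S\<^esub>"
      unfolding T_one[symmetric] by (simp add: AGL1_sq_def AGL1_def residue_ring_def)
    finally have "inv\<^bsub>BijGroup S\<^esub> f = aff a (- (a * b))"
      unfolding f a_def mult[symmetric] by (intro B.inv_equality cl)
    then show "inv\<^bsub>BijGroup S\<^esub> f \<in> carrier T" by (simp add: a_def)
  qed
  have "T = BijGroup S \<lparr>carrier := carrier T\<rparr>"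
    by (simp add: AGL1_sq_def AGL1_def residue_ring_def)
  with B.subgroup_imp_group[OF sub] show ?thesis by simp
qed

sublocale T: group T by (rule group_T)

lemma translation_pow: "aff 1 b [^]\<^bsub>T\<^esub> (n::nat) = aff 1 (int n * b)"
proof (induction n)
  case 0
  then show ?case by (simp add: T_one)
next
  case (Suc n)
  then show ?case by (simp add: aff_mult algebra_simps)
qed

lemma scaling_pow: "aff (int r ^ j) 0 [^]\<^bsub>T\<^esub> (n::nat) = aff (int r ^ (j * n)) 0"
proof (induction n)
  case 0
  then show ?case by (simp add: T_one)
next
  case (Suc n)
  then show ?case by (simp add: aff_mult add.commute flip: power_add)
qed

lemma aff_closed_1 [simp]: "aff 1 b \<in> carrier T"
  using aff_closed[of 0 b] by simp

lemma r_pow_mod: "[int r ^ j = int r ^ (j mod q)] (mod int p)"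
proof -
  have "int r ^ j = int r ^ (q * (j div q)) * int r ^ (j mod q)" by (simp flip: power_add)
  moreover have "[int r ^ (q * (j div q)) * int r ^ (j mod q) = 1 * int r ^ (j mod q)] (mod int p)"
    using int_cong_pow[of "q * (j div q)"] by (intro cong_mult cong_refl) simp
  ultimately show ?thesis by simp
qed

lemma T_bij: "bij_betw (\<lambda>(i, j). aff (int r ^ j) (int i)) ({..<p} \<times> {..<q}) (carrier T)"
  unfolding bij_betw_def
proof
  show "inj_on (\<lambda>(i, j). aff (int r ^ j) (int i)) ({..<p} \<times> {..<q})"
  proof (rule inj_onI, clarsimp)
    fix i j i' j' assume *: "i < p" "j < q" "i' < p" "j' < q"
      and eq: "aff (int r ^ j) (int i) = aff (int r ^ j') (int i')"
    have "[i = i'] (mod p)" using aff_eq_imp_cong(2)[OF eq] by (simp add: cong_int_iff)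
    then have i: "i = i'" using * cong_less_modulus_unique_nat by blast
    have wlog: "b = a" if "a \<le> b" "b < q" "[int r ^ a = int r ^ b] (mod int p)" for a b
    proof -
      have "[int r ^ a * 1 = int r ^ a * int r ^ (b - a)] (mod int p)"
        using that by (simp flip: power_add)
      then have "[1 = int r ^ (b - a)] (mod int p)"
        by (rule iffD1[OF cong_mult_lcancel, rotated]) simp
      then have "q dvd b - a" using int_cong_pow cong_sym by blast
      then show ?thesis using that by (auto dest: dvd_imp_le)
    qed
    have "[int r ^ j = int r ^ j'] (mod int p)" by (rule aff_eq_imp_cong(1)[OF eq])
    then have "j = j'" using wlog[of j j'] wlog[of j' j] * cong_sym by (metis nat_le_linear)
    with i show "i = i' \<and> j = j'" by simp
  qed
  show "(\<lambda>(i, j). aff (int r ^ j) (int i)) ` ({..<p} \<times> {..<q}) = carrier T"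
  proof (intro equalityI subsetI)
    fix f assume "f \<in> carrier T"
    then obtain j b where f: "f = aff (int r ^ j) b" unfolding T_carrier_eq by blast
    have "f = aff (int r ^ (j mod q)) (int (nat (b mod int p)))"
      unfolding f using r_pow_mod p_pos by (intro aff_cong) (simp_all add: cong_def)
    moreover have "nat (b mod int p) < p" "j mod q < q" using p_pos q_pos by (simp_all add: nat_less_iff)
    ultimately show "f \<in> (\<lambda>(i, j). aff (int r ^ j) (int i)) ` ({..<p} \<times> {..<q})"
      by (intro image_eqI[of _ _ "(nat (b mod int p), j mod q)"]) simp_all
  qed auto
qed

lemma card_T: "card (carrier T) = p * q"
  using bij_betw_same_card[OF T_bij] by (simp add: card_cartesian_product)

end


section \<open>The generators of the direct product\<close>

lemma DirProd_nat_pow: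
  "(a, b) [^]\<^bsub>G \<times>\<times> H\<^esub> (n::nat) = (a [^]\<^bsub>G\<^esub> n, b [^]\<^bsub>H\<^esub> n)"
  by (induction n) simp_all

lemma (in group) subgroup_nat_pow_closed:
  "subgroup H G \<Longrightarrow> a \<in> H \<Longrightarrow> a [^] (n::nat) \<in> H"
  using subgroup_int_pow_closed[of H a "int n"] by (simp add: int_pow_int)

lemma (in group) conjugate_mem_subgroup:
  "subgroup H G \<Longrightarrow> a \<in> H \<Longrightarrow> b \<in> H \<Longrightarrow> conjugate G a b \<in> H"
  by (simp add: conjugate_def subgroup.m_closed subgroup.m_inv_closed)

lemma funpow_fixed: "f x = x \<Longrightarrow> (f ^^ n) x = x"
  by (induction n) simp_all

lemma funpow_fixed_orbit:
  assumes "(f ^^ n) a = a" shows "(f ^^ n) ((f ^^ k) a) = (f ^^ k) a"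
proof -
  have "(f ^^ n) ((f ^^ k) a) = (f ^^ (n + k)) a" by (simp add: funpow_add)
  also have "\<dots> = (f ^^ k) ((f ^^ n) a)" by (simp add: add.commute[of n] funpow_add)
  finally show ?thesis by (simp add: assms)
qed

lemma alt_group_nat_pow: "f [^]\<^bsub>alt_group n\<^esub> (k::nat) = f ^^ k"
proof (induction k)
  case 0
  then show ?case by (simp add: alt_group_one)
next
  case (Suc k)
  then show ?case by (simp add: alt_group_mult funpow_Suc_right del: funpow.simps)
qed

context prime_11_mod_12
begin

declare add_2_eq_Suc' [simp del]

abbreviation "A \<equiv> alt_group (p + 2)"

abbreviation "D \<equiv> A \<times>\<times> T"

sublocale A: group A by (rule alt_group_is_group)

sublocale D: group D by (rule DirProd_group[OF alt_group_is_group group_T])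

text \<open>The residue \<open>v\<close> modulo \<open>p\<close> corresponds to the point \<open>v + 1\<close> of \<open>{1..p}\<close>.\<close>

definition emb :: "(int \<Rightarrow> int) \<Rightarrow> nat \<Rightarrow> nat" where
  "emb f k = (if k \<in> {1..p} then nat (f (int k - 1)) + 1 else k)"

definition pt :: "int \<Rightarrow> nat" where
  "pt v = nat (v mod int p) + 1"

lemma T_Bij: "f \<in> carrier T \<Longrightarrow> f \<in> Bij S"
  unfolding T_carrier_eq using aff_Bij by auto

lemma T_maps: "f \<in> carrier T \<Longrightarrow> v \<in> S \<Longrightarrow> f v \<in> S"
  using Bij_imp_funcset[OF T_Bij] by blast

lemma emb_mult:
  assumes "f \<in> carrier T" "g \<in> carrier T"
  shows "emb (f \<otimes>\<^bsub>T\<^esub> g) = emb f \<circ> emb g"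
proof
  fix k
  show "emb (f \<otimes>\<^bsub>T\<^esub> g) k = (emb f \<circ> emb g) k"
  proof (cases "k \<in> {1..p}")
    case True
    then have k: "int k - 1 \<in> S" by auto
    have "g (int k - 1) \<in> S" by (rule T_maps[OF assms(2) k])
    then have "nat (g (int k - 1)) + 1 \<in> {1..p}" "int (nat (g (int k - 1)) + 1) - 1 = g (int k - 1)"
      by auto
    moreover have "(f \<otimes>\<^bsub>T\<^esub> g) (int k - 1) = f (g (int k - 1))"
      using assms k T_Bij by (simp add: T_mult compose_def)
    ultimately show ?thesis using True unfolding comp_def emb_def by simp
  next
    case False
    then show ?thesis by (simp only: comp_def emb_def if_False)
  qed
qed

lemma emb_permutes:
  assumes "f \<in> carrier T"
  shows "emb f permutes {1..p}"
proof (rule bij_imp_permutes)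
  have bij: "inj_on f S" using T_Bij[OF assms] by (simp add: Bij_def bij_betw_def)
  have maps: "f (int k - 1) \<in> S" if "k \<in> {1..p}" for k
    using that by (intro T_maps[OF assms]) auto
  have "inj_on (emb f) {1..p}"
  proof (rule inj_onI)
    fix k l assume kl: "k \<in> {1..p}" "l \<in> {1..p}" "emb f k = emb f l"
    then have "nat (f (int k - 1)) = nat (f (int l - 1))" by (simp add: emb_def)
    then have eq: "f (int k - 1) = f (int l - 1)"
      using maps[OF kl(1)] maps[OF kl(2)] by (simp add: eq_nat_nat_iff)
    have "int k - 1 = int l - 1"
      using inj_onD[OF bij eq] kl(1,2) by simp
    then show "k = l" by simp
  qed
  moreover have "emb f ` {1..p} \<subseteq> {1..p}"
  proof (rule image_subsetI)
    fix k assume k: "k \<in> {1..p}"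
    then show "emb f k \<in> {1..p}" using maps[OF k] by (auto simp: emb_def)
  qed
  ultimately show "bij_betw (emb f) {1..p} {1..p}"
    by (simp add: bij_betw_def endo_inj_surj)
qed (simp only: emb_def if_False)

text \<open>The group \<open>T\<close> has odd order, so all its elements are squares.\<close>

lemma emb_closed:
  assumes "f \<in> carrier T"
  shows "emb f \<in> carrier A"
proof -
  have "odd (p * q)" using p_eq odd_q by simp
  then obtain k where k: "p * q = 2 * k + 1" by (rule oddE)
  define g where "g = f [^]\<^bsub>T\<^esub> (k + 1)"
  have g: "g \<in> carrier T" using assms by (simp add: g_def)
  have "f [^]\<^bsub>T\<^esub> (2 * k + 1) = \<one>\<^bsub>T\<^esub>"
    using T.pow_order_eq_1[OF assms] card_T by (simp only: order_def k)
  moreover have "g \<otimes>\<^bsub>T\<^esub> g = f [^]\<^bsub>T\<^esub> (2 * k + 1) \<otimes>\<^bsub>T\<^esub> f"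
  proof -
    have "g \<otimes>\<^bsub>T\<^esub> g = f [^]\<^bsub>T\<^esub> ((k + 1) + (k + 1))"
      using assms by (simp only: g_def T.nat_pow_mult)
    also have "(k + 1) + (k + 1) = Suc (2 * k + 1)" by simp
    finally show ?thesis by (simp only: T.nat_pow_Suc)
  qed
  ultimately have f: "emb f = emb g \<circ> emb g"
    using assms by (simp flip: emb_mult[OF g g])
  have "emb f permutes {1..p + 2}"
    by (rule permutes_subset[OF emb_permutes[OF assms]]) auto
  moreover have "permutation (emb g)"
    using emb_permutes[OF g] by (auto simp: permutation_permutes)
  then have "evenperm (emb f)" by (simp add: f evenperm_comp)
  ultimately show ?thesis by (simp only: alt_group_carrier simp_thms)
qed

lemma pt_eq_iff: "pt v = pt w \<longleftrightarrow> [v = w] (mod int p)"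
  using p_pos by (auto simp: pt_def cong_def eq_nat_nat_iff)

lemma pt_in: "pt v \<in> {1..p}"
  using p_pos by (auto simp: pt_def Suc_le_eq nat_less_iff)

lemma pt_surj: "k \<in> {1..p} \<Longrightarrow> k = pt (int k - 1)"
  by (auto simp: pt_def)

lemma pt_0: "pt 0 = 1" and pt_1: "pt 1 = 2" and pt_minus_1: "pt (-1) = p"
  using p_gt_2 by (simp_all add: pt_def zmod_minus1 nat_diff_distrib)

lemma emb_aff: "emb (aff a b) (pt v) = pt (a * v + b)"
proof -
  have "int (pt v) - 1 = v mod int p" using p_pos by (simp add: pt_def)
  then have "emb (aff a b) (pt v) = nat (aff a b (v mod int p)) + 1"
    using pt_in[of v] by (simp add: emb_def)
  also have "aff a b (v mod int p) = (a * (v mod int p) + b) mod int p" by (intro aff_apply mod_S)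
  also have "\<dots> = (a * v + b) mod int p" by (metis mod_add_left_eq mod_mult_right_eq)
  finally show ?thesis by (simp add: pt_def)
qed

section \<open>Generators of \<open>T\<close>\<close>

definition "xi = aff 1 1"
definition "eta = aff (int r) 0"
text \<open>A cube root of \<open>eta\<close>, as 3m = q + 1 is congruent to 1 modulo
  \<open>q\<close>. It will be the component in \<open>T\<close> of the generator
  \<open>gg\<close>.\<close>

definition "gam = aff (int r ^ m) 0"

lemma generators_closed [simp]: "xi \<in> carrier T" "eta \<in> carrier T" "gam \<in> carrier T"
  using aff_closed[of 1 0] by (simp_all add: xi_def eta_def gam_def)

lemma xi_pow: "xi [^]\<^bsub>T\<^esub> (n::nat) = aff 1 (int n)"
  by (simp add: xi_def translation_pow)

lemma eta_pow: "eta [^]\<^bsub>T\<^esub> (n::nat) = aff (int r ^ n) 0"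
  using scaling_pow[of 1 n] by (simp add: eta_def)

lemma gam_pow: "gam [^]\<^bsub>T\<^esub> (n::nat) = aff (int r ^ (m * n)) 0"
  by (simp add: gam_def scaling_pow)

lemma aff_eq_scaling: "[k = k'] (mod q) \<Longrightarrow> aff (int r ^ k) 0 = aff (int r ^ k') 0"
  using r_pow_mod[of k] r_pow_mod[of k'] unfolding cong_def[of k k' q]
  by (intro aff_cong) (metis cong_sym cong_trans, simp)

lemma eta_pow_Suc_q: "eta [^]\<^bsub>T\<^esub> (q + 1) = eta"
proof -
  have "[q + 1 = 1] (mod q)" by (simp only: cong_def mod_add_self1)
  from aff_eq_scaling[OF this] show ?thesis unfolding eta_pow unfolding eta_def by simp
qed

lemma gam_pow_3: "gam [^]\<^bsub>T\<^esub> (3::nat) = eta"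
proof -
  have "m * 3 = q + 1" using q3 by simp
  then show ?thesis unfolding gam_pow by (metis eta_pow eta_pow_Suc_q)
qed

lemma gam_pow_q: "gam [^]\<^bsub>T\<^esub> q = \<one>\<^bsub>T\<^esub>"
  using aff_eq_scaling[of "m * q" 0] by (simp add: gam_pow T_one cong_def)

lemma eta_pow_q: "eta [^]\<^bsub>T\<^esub> q = \<one>\<^bsub>T\<^esub>"
  using aff_eq_scaling[of q 0] by (simp add: eta_pow T_one cong_def)

lemma xi_pow_p: "xi [^]\<^bsub>T\<^esub> p = \<one>\<^bsub>T\<^esub>"
  unfolding xi_pow T_one by (rule aff_cong) (simp_all add: cong_def)

lemma conjugate_eta_xi: "conjugate T eta (xi [^]\<^bsub>T\<^esub> (t + 1)) = xi [^]\<^bsub>T\<^esub> t"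
proof -
  have "eta \<otimes>\<^bsub>T\<^esub> xi [^]\<^bsub>T\<^esub> (t + 1) = aff (int r) (int r * (int t + 1))"
    using aff_mult[of "int r" 1 0 "int t + 1"] by (simp only: xi_pow eta_def) (simp add: add.commute)
  also have "\<dots> = aff (int r) (int t)" by (rule aff_cong[OF cong_refl t_cong_int])
  also have "\<dots> = xi [^]\<^bsub>T\<^esub> t \<otimes>\<^bsub>T\<^esub> eta"
    using aff_mult[of 1 "int r" "int t" 0] by (simp add: xi_pow eta_def)
  finally show ?thesis by (subst T.conjugate_eq_iff) simp_all
qed

lemma inv_xi: "inv\<^bsub>T\<^esub> xi = aff 1 (-1)"
  using aff_mult[of 1 1 "-1" 1] by (intro T.inv_equality) (simp_all add: xi_def T_one)

lemma T_span: 
  assumes "f \<in> carrier T"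
  obtains i j :: nat where "f = xi [^]\<^bsub>T\<^esub> i \<otimes>\<^bsub>T\<^esub> eta [^]\<^bsub>T\<^esub> j"
proof -
  obtain j b where f: "f = aff (int r ^ j) b" using assms unfolding T_carrier_eq by blast
  have "f = aff (int r ^ j) (int (nat (b mod int p)))"
    unfolding f using p_pos by (intro aff_cong) (simp_all add: cong_def)
  also have "\<dots> = xi [^]\<^bsub>T\<^esub> nat (b mod int p) \<otimes>\<^bsub>T\<^esub> eta [^]\<^bsub>T\<^esub> j"
    unfolding xi_pow eta_pow by (subst aff_mult) simp_all
  finally show ?thesis using that by blast
qed

lemma normal_closure_eta: "normal_closure T {eta} = carrier T"
proof
  have N: "normal_closure T {eta} \<lhd> T" by (rule T.normal_normal_closure) simp
  interpret N: normal "normal_closure T {eta}" T by (rule N)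
  show "normal_closure T {eta} \<subseteq> carrier T" by (rule N.subset)
  have eta: "eta \<in> normal_closure T {eta}" by (rule T.normal_closure_incl) simp_all
  define b where "b = aff 1 (int t + 1)"
  have b: "b \<in> carrier T" by (simp add: b_def)
  have "conjugate T b eta = xi \<otimes>\<^bsub>T\<^esub> eta"
  proof (subst T.conjugate_eq_iff)
    have "b \<otimes>\<^bsub>T\<^esub> eta = aff (int r) (int t + 1)"
      using aff_mult[of 1 "int r" "int t + 1" 0] by (simp add: b_def eta_def)
    also have "\<dots> = aff (int r) (int r * (int t + 1) + 1)"
      using cong_add[OF cong_sym[OF t_cong_int] cong_refl[of 1]] by (intro aff_cong cong_refl) simp
    also have "\<dots> = aff (int r) 1 \<otimes>\<^bsub>T\<^esub> b"
      using aff_mult[of "int r" 1 1 "int t + 1"] by (simp add: b_def)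
    also have "aff (int r) 1 = xi \<otimes>\<^bsub>T\<^esub> eta"
      using aff_mult[of 1 "int r" 1 0] by (simp add: xi_def eta_def)
    finally show "b \<otimes>\<^bsub>T\<^esub> eta = (xi \<otimes>\<^bsub>T\<^esub> eta) \<otimes>\<^bsub>T\<^esub> b" .
  qed (simp_all add: b)
  then have "xi \<otimes>\<^bsub>T\<^esub> eta \<in> normal_closure T {eta}"
    using N.inv_op_closed2[OF b eta] by (simp add: conjugate_def)
  then have "xi \<otimes>\<^bsub>T\<^esub> eta \<otimes>\<^bsub>T\<^esub> inv\<^bsub>T\<^esub> eta \<in> normal_closure T {eta}"
    by (rule N.m_closed[OF _ N.m_inv_closed[OF eta]])
  then have xi: "xi \<in> normal_closure T {eta}" by (simp add: T.m_assoc)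
  show "carrier T \<subseteq> normal_closure T {eta}"
  proof
    fix f assume "f \<in> carrier T"
    then obtain i j :: nat where "f = xi [^]\<^bsub>T\<^esub> i \<otimes>\<^bsub>T\<^esub> eta [^]\<^bsub>T\<^esub> j" by (rule T_span)
    then show "f \<in> normal_closure T {eta}"
      using T.subgroup_nat_pow_closed[OF N.subgroup_axioms] xi eta by (simp add: N.m_closed)
  qed
qed

section \<open>The diagonal copy of \<open>T\<close> and the 3-cycles in the direct product\<close>

definition "J f = (emb f, f)"

lemma J_closed [simp]: "f \<in> carrier T \<Longrightarrow> J f \<in> carrier D"
  by (simp add: J_def emb_closed)

lemma J_hom: "J \<in> hom T D"
  by (rule homI) (simp_all add: J_def emb_closed emb_mult alt_group_mult)

lemma J_pow: "f \<in> carrier T \<Longrightarrow> J f [^]\<^bsub>D\<^esub> (n::nat) = J (f [^]\<^bsub>T\<^esub> n)"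
  using hom_nat_pow[OF J_hom _ group_T D.is_group] by simp

lemma J_mult: "f \<in> carrier T \<Longrightarrow> g \<in> carrier T \<Longrightarrow> J f \<otimes>\<^bsub>D\<^esub> J g = J (f \<otimes>\<^bsub>T\<^esub> g)"
  using hom_mult[OF J_hom] by simp

lemma J_one: "J \<one>\<^bsub>T\<^esub> = \<one>\<^bsub>D\<^esub>"
  using hom_one[OF J_hom group_T D.is_group] .

lemma J_inv: "f \<in> carrier T \<Longrightarrow> inv\<^bsub>D\<^esub> J f = J (inv\<^bsub>T\<^esub> f)"
  using group_hom.hom_inv[of T D J f] J_hom group_T D.is_group
  by (simp add: group_hom_def group_hom_axioms_def)

lemma J_conjugate:
  assumes "f \<in> carrier T" "g \<in> carrier T"
  shows "conjugate D (J f) (J g) = J (conjugate T f g)"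
  using assms by (simp add: conjugate_def J_mult J_inv)

definition "tr i = (tri p i, \<one>\<^bsub>T\<^esub>)"

lemma tr_closed [simp]: "i \<in> {1..p} \<Longrightarrow> tr i \<in> carrier D"
  using tri_closed by (simp add: tr_def)

lemma tr_cube: "i \<in> {1..p} \<Longrightarrow> tr i [^]\<^bsub>D\<^esub> (3::nat) = \<one>\<^bsub>D\<^esub>"
  using tri_cube[of i p] by (simp add: tr_def DirProd_nat_pow numeral_3_eq_3 alt_group_mult alt_group_one)

lemma emb_in: "f \<in> carrier T \<Longrightarrow> i \<in> {1..p} \<Longrightarrow> emb f i \<in> {1..p}"
  using permutes_in_image[OF emb_permutes] by blast

lemma conjugate_J_tr:
  assumes "f \<in> carrier T" "i \<in> {1..p}"
  shows "conjugate D (J f) (tr i) = tr (emb f i)"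
proof (subst D.conjugate_eq_iff)
  show "J f \<otimes>\<^bsub>D\<^esub> tr i = tr (emb f i) \<otimes>\<^bsub>D\<^esub> J f"
    using tri_conj[OF emb_permutes[OF assms(1)], of i] assms(1)
    by (simp add: J_def tr_def alt_group_mult)
qed (simp_all only: J_closed tr_closed emb_in assms)

definition "gx = J xi"
text \<open>The exponent 2 is the inverse of \<open>q\<close> modulo 3, chosen so that the
  \<open>q\<close>-th power is \<open>tr 1\<close> itself.\<close>

definition "gg = J gam \<otimes>\<^bsub>D\<^esub> tr 1 [^]\<^bsub>D\<^esub> (2::nat)"

lemma one_in: "1 \<in> {1..p}" and two_in: "2 \<in> {1..p}" and p_in: "p \<in> {1..p}"
  using p_gt_2 by auto

lemma gx_closed [simp]: "gx \<in> carrier D" and gg_closed [simp]: "gg \<in> carrier D"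
  using one_in by (simp_all only: gx_def gg_def J_closed generators_closed D.m_closed D.nat_pow_closed tr_closed)

text \<open>The scaling \<open>gam\<close> fixes the residue 0, which is the point 1. Hence
  \<open>J gam\<close> commutes with \<open>tr 1\<close>.\<close>

lemma gg_pow: "gg [^]\<^bsub>D\<^esub> (n::nat) = J (gam [^]\<^bsub>T\<^esub> n) \<otimes>\<^bsub>D\<^esub> tr 1 [^]\<^bsub>D\<^esub> (2 * n)"
proof -
  have "emb gam 1 = 1" using emb_aff[of "int r ^ m" 0 0] by (simp add: gam_def pt_0)
  then have "conjugate D (J gam) (tr 1 [^]\<^bsub>D\<^esub> (2::nat)) = tr 1 [^]\<^bsub>D\<^esub> (2::nat)"
    using one_in conjugate_J_tr[of gam 1] by (subst D.conjugate_pow) (simp_all only: J_closed generators_closed tr_closed)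
  then have "J gam \<otimes>\<^bsub>D\<^esub> tr 1 [^]\<^bsub>D\<^esub> (2::nat) = tr 1 [^]\<^bsub>D\<^esub> (2::nat) \<otimes>\<^bsub>D\<^esub> J gam"
    by (subst (asm) D.conjugate_eq_iff) (use one_in in \<open>simp_all only: J_closed generators_closed tr_closed D.nat_pow_closed\<close>)
  then have "gg [^]\<^bsub>D\<^esub> n = J gam [^]\<^bsub>D\<^esub> n \<otimes>\<^bsub>D\<^esub> (tr 1 [^]\<^bsub>D\<^esub> (2::nat)) [^]\<^bsub>D\<^esub> n"
    unfolding gg_def by (rule D.pow_mult_distrib) (use one_in in \<open>simp_all only: J_closed generators_closed tr_closed D.nat_pow_closed\<close>)
  then show ?thesis using one_in by (simp only: J_pow generators_closed D.nat_pow_pow tr_closed)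
qed

lemma tr_1_pow_cong: "[a = b] (mod 3) \<Longrightarrow> tr 1 [^]\<^bsub>D\<^esub> (a::nat) = tr 1 [^]\<^bsub>D\<^esub> b"
  using one_in by (intro D.pow_cong[OF _ tr_cube]) (simp_all only: tr_closed)

lemma gg_pow_3: "gg [^]\<^bsub>D\<^esub> (3::nat) = J eta"
proof -
  have "tr 1 [^]\<^bsub>D\<^esub> (2 * 3::nat) = tr 1 [^]\<^bsub>D\<^esub> (0::nat)" by (rule tr_1_pow_cong) (simp add: cong_def)
  then show ?thesis unfolding gg_pow gam_pow_3
    by (simp only: D.nat_pow_0 D.r_one J_closed generators_closed)
qed

lemma gg_pow_q: "gg [^]\<^bsub>D\<^esub> q = tr 1"
proof -
  have "2 * q = 3 * (2 * m - 1) + 1" using q3 by simp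
  then have "tr 1 [^]\<^bsub>D\<^esub> (2 * q) = tr 1 [^]\<^bsub>D\<^esub> (1::nat)"
    by (intro tr_1_pow_cong) (simp only: cong_def mod_mult_self4)
  then show ?thesis unfolding gg_pow gam_pow_q J_one
    using one_in by (simp only: D.nat_pow_eone D.l_one tr_closed)
qed

lemma conjugate_gx: "conjugate D gx (tr 1) = tr 2" "conjugate D (inv\<^bsub>D\<^esub> gx) (tr 1) = tr p"
proof -
  have "emb xi 1 = 2" using emb_aff[of 1 1 0] by (simp add: xi_def pt_0 pt_1)
  then show "conjugate D gx (tr 1) = tr 2"
    using conjugate_J_tr[OF _ one_in, of xi] by (simp only: gx_def generators_closed)
  have "emb (inv\<^bsub>T\<^esub> xi) 1 = p" using emb_aff[of 1 "-1" 0] by (simp add: inv_xi pt_0 pt_minus_1)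
  then show "conjugate D (inv\<^bsub>D\<^esub> gx) (tr 1) = tr p"
    using conjugate_J_tr[OF _ one_in, of "inv\<^bsub>T\<^esub> xi"]
    by (simp only: gx_def J_inv generators_closed T.inv_closed)
qed

lemma D_rel1: "gx [^]\<^bsub>D\<^esub> p = gg [^]\<^bsub>D\<^esub> (3 * q)"
proof -
  have "gg [^]\<^bsub>D\<^esub> (3 * q) = J eta [^]\<^bsub>D\<^esub> q"
    by (simp only: gg_pow_3[symmetric] D.nat_pow_pow gg_closed)
  then show ?thesis
    by (simp only: gx_def J_pow generators_closed xi_pow_p eta_pow_q)
qed

lemma D_rel2: "conjugate D (gg [^]\<^bsub>D\<^esub> (3::nat)) (gx [^]\<^bsub>D\<^esub> (t + 1)) = gx [^]\<^bsub>D\<^esub> t"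
  by (simp only: gx_def gg_pow_3 J_pow generators_closed J_conjugate T.nat_pow_closed conjugate_eta_xi)

lemma D_rel3: "(gg [^]\<^bsub>D\<^esub> q \<otimes>\<^bsub>D\<^esub> conjugate D gx (gg [^]\<^bsub>D\<^esub> q)) [^]\<^bsub>D\<^esub> (2::nat) = \<one>\<^bsub>D\<^esub>"
proof -
  have "tr 1 \<otimes>\<^bsub>D\<^esub> tr 2 = (tri p 1 \<circ> tri p 2, \<one>\<^bsub>T\<^esub>)" by (simp add: tr_def alt_group_mult)
  moreover have "f ^^ 2 = f \<circ> f" for f :: "nat \<Rightarrow> nat" by (simp add: numeral_2_eq_2)
  ultimately show ?thesis
    using tri_mult_tri_square[OF one_in two_in] unfolding gg_pow_q conjugate_gx
    by (simp add: DirProd_nat_pow alt_group_nat_pow alt_group_one)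
qed

text \<open>The permutation \<open>th\<close> consists of a fixed point and of two cycles of length \<open>q + 1\<close>, one through
  \<open>p + 1\<close> and the squares, the other through \<open>p + 2\<close> and the nonsquares. Since \<open>q + 1\<close> is
  coprime to the order \<open>q\<close> of \<open>eta\<close>, its \<open>(q + 1)\<close>-st power separates the two factors of \<open>D\<close>.\<close>

definition th :: "nat \<Rightarrow> nat" where
  "th = emb eta \<circ> (tri p 2 \<circ> tri p p)"

lemma th_eq: "th = emb eta \<circ> (transpose 2 (p + 1) \<circ> transpose p (p + 2))"
  using tri_mult_tri[OF two_in p_in] p_gt_2 by (simp add: th_def)

lemma th_values:
  "th (p + 1) = pt (int r)" "th (p + 2) = pt (- int r)"
  "th 2 = p + 1" "th p = p + 2"
  "k \<notin> {1..p + 2} \<Longrightarrow> th k = k"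
  "pt v \<noteq> 2 \<Longrightarrow> pt v \<noteq> p \<Longrightarrow> th (pt v) = pt (int r * v)"
proof -
  have emb: "emb eta (pt w) = pt (int r * w)" for w
    using emb_aff[of "int r" 0 w] by (simp add: eta_def)
  have out: "emb eta k = k" if "k \<notin> {1..p}" for k
    using that by (simp only: emb_def if_False)
  show "th (p + 1) = pt (int r)" using emb[of 1] p_gt_2 by (simp add: th_eq transpose_def pt_1)
  show "th (p + 2) = pt (- int r)" using emb[of "-1"] p_gt_2 by (simp add: th_eq transpose_def pt_minus_1)
  show "th 2 = p + 1" using p_gt_2 by (simp add: th_eq transpose_def out)
  show "th p = p + 2" using p_gt_2 by (simp add: th_eq transpose_def out)
  show "th k = k" if "k \<notin> {1..p + 2}"
    using that p_gt_2 by (auto simp: th_eq transpose_def out)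
  show "th (pt v) = pt (int r * v)" if "pt v \<noteq> 2" "pt v \<noteq> p"
    using that pt_in[of v] emb[of v] by (simp add: th_eq transpose_def)
qed

text \<open>From the extra point the orbit enters the residues at plus or minus \<open>r\<close> and
  then moves by multiplication with \<open>r\<close>. Before step \<open>q\<close> it avoids 1 and
  -1, the points 2 and \<open>p\<close> at which \<open>th\<close> leaves the residues.\<close>

lemma th_orbit:
  fixes e :: int
  assumes e: "e = 1 \<and> a = p + 1 \<or> e = -1 \<and> a = p + 2" and k: "1 \<le> k" "k \<le> q"
  shows "(th ^^ k) a = pt (e * int r ^ k)"
  using k
proof (induction k rule: dec_induct)
  case base
  then show ?case using e th_values(1,2) by auto
next
  case (step k)
  have "\<not> q dvd k" using step by (auto dest: dvd_imp_le)
  then have k1: "\<not> [int r ^ k = 1] (mod int p)" by (simp add: int_cong_pow)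
  have "\<not> [e * int r ^ k = 1] (mod int p)" "\<not> [e * int r ^ k = -1] (mod int p)"
    using e k1 not_r_pow_cong_minus_1[of k] cong_minus_minus_iff[of "int r ^ k" 1 "int p"]
      cong_minus_minus_iff[of "int r ^ k" "-1" "int p"] by auto
  then have "pt (e * int r ^ k) \<noteq> 2" "pt (e * int r ^ k) \<noteq> p"
    using pt_eq_iff pt_1 pt_minus_1 by metis+
  then have "th (pt (e * int r ^ k)) = pt (int r * (e * int r ^ k))" by (rule th_values)
  then show ?case using step by (simp add: mult.left_commute)
qed

text \<open>Step \<open>q\<close> arrives at the residue \<open>e\<close>, and one further step
  returns to the extra point.\<close>

lemma th_cycle:
  fixes e :: int
  assumes e: "e = 1 \<and> a = p + 1 \<or> e = -1 \<and> a = p + 2"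
  shows "(th ^^ (q + 1)) a = a"
proof -
  have "(th ^^ q) a = pt (e * int r ^ q)" using q_pos by (intro th_orbit[OF e]) auto
  also have "\<dots> = pt (e * 1)" unfolding pt_eq_iff by (intro cong_mult cong_refl r_pow_q)
  finally have "(th ^^ (q + 1)) a = th (pt e)" by simp
  then show ?thesis using e pt_1 pt_minus_1 th_values(3,4) by auto
qed

lemma th_order: "th ^^ (q + 1) = id"
proof
  fix k
  have orbit: "(th ^^ (q + 1)) (pt (e * int r ^ j)) = pt (e * int r ^ j)"
    if e: "e = 1 \<and> a = p + 1 \<or> e = -1 \<and> a = p + 2" for e :: int and a j
  proof -
    \<comment> \<open>The representative of \<open>j\<close> modulo \<open>q\<close> is taken from 1
      to \<open>q\<close>, because exponent 0 gives the extra point \<open>a\<close> and not a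
      residue.\<close>
    define i where "i = (if j mod q = 0 then q else j mod q)"
    have i: "1 \<le> i" "i \<le> q" using q_pos mod_less_divisor[of q j] by (auto simp: i_def)
    have "i mod q = j mod q" by (simp add: i_def)
    then have "[int r ^ j = int r ^ i] (mod int p)"
      using r_pow_mod[of i] r_pow_mod[of j] by (metis cong_sym cong_trans)
    then have "pt (e * int r ^ j) = (th ^^ i) a"
      unfolding th_orbit[OF e i] pt_eq_iff by (intro cong_mult cong_refl)
    then show ?thesis using funpow_fixed_orbit[OF th_cycle[OF e]] by simp
  qed
  have "(th ^^ (q + 1)) k = k"
  proof (cases "k \<in> {1..p}")
    case True
    define v where "v = int k - 1"
    have k: "k = pt v" unfolding v_def using True by (rule pt_surj)
    show ?thesis
    proof (cases "int p dvd v")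
      case True
      then have "k = pt 0" unfolding k pt_eq_iff by (simp add: cong_0_iff)
      moreover have "th (pt 0) = pt 0" using th_values(6)[of 0] p_gt_2 by (simp add: pt_0)
      ultimately show ?thesis using funpow_fixed by metis
    next
      case False
      then obtain j where "[v = int r ^ j] (mod int p) \<or> [v = - (int r ^ j)] (mod int p)"
        using pm_r_pow_cong by blast
      then have "k = pt (1 * int r ^ j) \<or> k = pt (-1 * int r ^ j)" unfolding k pt_eq_iff by simp
      then show ?thesis using orbit[of 1 "p + 1" j] orbit[of "-1" "p + 2" j] by auto
    qed
  next
    case False
    then consider "k = p + 1" | "k = p + 2" | "k \<notin> {1..p + 2}" by fastforce
    then show ?thesis
    proof cases
      case 3
      then show ?thesis using funpow_fixed th_values(5) by metis
    qed (use th_cycle in auto)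
  qed
  then show "(th ^^ (q + 1)) k = id k" by simp
qed

lemma D_rel4:
  "(gg [^]\<^bsub>D\<^esub> (3::nat) \<otimes>\<^bsub>D\<^esub> (conjugate D gx (gg [^]\<^bsub>D\<^esub> q) \<otimes>\<^bsub>D\<^esub>
      conjugate D (inv\<^bsub>D\<^esub> gx) (gg [^]\<^bsub>D\<^esub> q))) [^]\<^bsub>D\<^esub> (q + 1) = (\<one>\<^bsub>A\<^esub>, eta)"
proof -
  have "J eta \<otimes>\<^bsub>D\<^esub> (tr 2 \<otimes>\<^bsub>D\<^esub> tr p) = (th, eta)"
    by (simp add: J_def tr_def th_def alt_group_mult)
  then show ?thesis unfolding gg_pow_q gg_pow_3 conjugate_gx
    by (simp only: DirProd_nat_pow alt_group_nat_pow th_order eta_pow_Suc_q alt_group_one)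
qed

section \<open>Generation and order of the direct product\<close>

lemma D_generated: "generate D {gx, gg} = carrier D"
proof
  have sub: "{gx, gg} \<subseteq> carrier D" using gx_closed gg_closed by blast
  define H where "H = generate D {gx, gg}"
  have H: "subgroup H D" unfolding H_def by (rule D.generate_is_subgroup[OF sub])
  show "generate D {gx, gg} \<subseteq> carrier D" by (rule D.generate_incl[OF sub])
  have gx: "gx \<in> H" and gg: "gg \<in> H" unfolding H_def by (auto intro: generate.incl)
  note pow = D.subgroup_nat_pow_closed[OF H]
  have eta: "J eta \<in> H" using pow[OF gg, of 3] by (simp only: gg_pow_3)
  have tr1: "tr 1 \<in> H" using pow[OF gg, of q] by (simp only: gg_pow_q)
  have tr: "tr i \<in> H" if "i \<in> {1..p}" for i
  proof -
    have "J (xi [^]\<^bsub>T\<^esub> (i - 1)) \<in> H"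
      using pow[OF gx, of "i - 1"] by (simp only: gx_def J_pow generators_closed)
    then have "conjugate D (J (xi [^]\<^bsub>T\<^esub> (i - 1))) (tr 1) \<in> H"
      using tr1 by (intro D.conjugate_mem_subgroup[OF H])
    moreover have "emb (xi [^]\<^bsub>T\<^esub> (i - 1)) 1 = i"
      using emb_aff[of 1 "int (i - 1)" 0] pt_surj[OF that] that
      unfolding xi_pow pt_0 by (simp add: of_nat_diff)
    ultimately show ?thesis
      using conjugate_J_tr[OF _ one_in, of "xi [^]\<^bsub>T\<^esub> (i - 1)"]
      by (simp only: T.nat_pow_closed generators_closed)
  qed
  \<comment> \<open>The part of \<open>H\<close> inside the first factor. It contains all the
    3-cycles \<open>tri p i\<close>, hence is the whole alternating group.\<close>
  define K where "K = {s \<in> carrier A. (s, \<one>\<^bsub>T\<^esub>) \<in> H}"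
  have "subgroup K A"
  proof (rule A.subgroupI)
    show "K \<subseteq> carrier A" by (auto simp: K_def)
    show "K \<noteq> {}" using subgroup.one_closed[OF H] by (auto simp: K_def)
    fix s assume s: "s \<in> K"
    then show "inv\<^bsub>A\<^esub> s \<in> K"
      using subgroup.m_inv_closed[OF H, of "(s, \<one>\<^bsub>T\<^esub>)"]
      by (simp add: K_def inv_DirProd[OF alt_group_is_group group_T])
    fix s' assume "s' \<in> K"
    then show "s \<otimes>\<^bsub>A\<^esub> s' \<in> K"
      using s subgroup.m_closed[OF H, of "(s, \<one>\<^bsub>T\<^esub>)" "(s', \<one>\<^bsub>T\<^esub>)"] by (simp add: K_def)
  qed
  then have K: "K = carrier A"
    by (rule alt_group_subgroup_tri) (use tr tri_closed in \<open>auto simp: K_def tr_def\<close>)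
  have JH: "J f \<in> H" if "f \<in> carrier T" for f
  proof -
    obtain i j :: nat where "f = xi [^]\<^bsub>T\<^esub> i \<otimes>\<^bsub>T\<^esub> eta [^]\<^bsub>T\<^esub> j" using \<open>f \<in> carrier T\<close> by (rule T_span)
    then have "J f = gx [^]\<^bsub>D\<^esub> i \<otimes>\<^bsub>D\<^esub> J eta [^]\<^bsub>D\<^esub> j"
      by (simp only: gx_def J_pow J_mult generators_closed T.nat_pow_closed)
    then show ?thesis using subgroup.m_closed[OF H pow[OF gx] pow[OF eta]] by metis
  qed
  show "carrier D \<subseteq> generate D {gx, gg}"
  proof
    fix w assume "w \<in> carrier D"
    then obtain s f where w: "w = (s, f)" "s \<in> carrier A" "f \<in> carrier T" by auto
    \<comment> \<open>Splitting off the diagonal element \<open>J f\<close> leaves an element of the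
      first factor.\<close>
    define u where "u = s \<otimes>\<^bsub>A\<^esub> inv\<^bsub>A\<^esub> emb f"
    have "u \<in> K" unfolding K u_def using w emb_closed by simp
    then have "(u, \<one>\<^bsub>T\<^esub>) \<otimes>\<^bsub>D\<^esub> J f \<in> H"
      using subgroup.m_closed[OF H _ JH[OF w(3)]] by (simp only: K_def mem_Collect_eq)
    moreover have "(u, \<one>\<^bsub>T\<^esub>) \<otimes>\<^bsub>D\<^esub> J f = w"
      using w emb_closed[OF w(3)] by (simp add: u_def J_def A.m_assoc)
    ultimately show "w \<in> generate D {gx, gg}" unfolding H_def by simp
  qed
qed

text \<open>This is exactly the upper bound of \<open>card_carrier_le\<close>, so the presented
  group cannot be larger than \<open>D\<close>.\<close>

lemma card_D: "2 * card (carrier D) = fact (p + 2) * (p * q)"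
proof -
  have "card (carrier D) = card (carrier A) * card (carrier T)"
    by (simp add: card_cartesian_product)
  then show ?thesis using alt_group_card_carrier[of "p + 2"] card_T by (simp del: fact_Suc)
qed

end


section \<open>The presentations\<close>

lemma (in group) int_pow_numeral: "a [^] (numeral n :: int) = a [^] (numeral n :: nat)"
  using int_pow_int[of G a "numeral n"] by simp

lemma (in group) int_pow_minus_one: "a \<in> carrier G \<Longrightarrow> a [^] (- 1 :: int) = inv a"
  by (simp add: int_pow_neg)

definition conj_word :: "'x pword \<Rightarrow> 'x pword \<Rightarrow> 'x pword" where
  "conj_word u v = Mul (Mul u v) (Pow u (- 1))"

lemma (in group) pword_val_conj_word:
  assumes "pword_val G f u \<in> carrier G"
  shows "pword_val G f (conj_word u v) = conjugate G (pword_val G f u) (pword_val G f v)"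
  using assms by (simp add: conj_word_def conjugate_def int_pow_minus_one)

lemma bl_conj_word: "bl (conj_word u v) = bl u + bl v + bl u"
  by (simp add: conj_word_def)

lemma set_conj_word: "set_pword (conj_word u v) = set_pword u \<union> set_pword v"
  by (auto simp: conj_word_def)

lemma bl_Pow_le:
  assumes "N \<ge> 1" "\<bar>real_of_int n\<bar> \<le> N"
  shows "bl (Pow w n) \<le> bl w + log 2 N"
proof (cases "n \<in> {- 1, 0, 1}")
  case True
  then show ?thesis using assms(1) by auto
next
  case False
  then have "\<bar>real_of_int n\<bar> > 0" by auto
  then have "log 2 \<bar>real_of_int n\<bar> \<le> log 2 N" using assms by simp
  then show ?thesis using False by simp
qed

section \<open>The relators as words, and their bit-lengths\<close>

context prime_11_mod_12
begin

text \<open>The letter 0 stands for \<open>x\<close> and the letter 1 for \<open>g\<close>; this is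
  the word for the element \<open>y\<close>, and \<open>wz\<close> the one for
  \<open>z\<close>.\<close>

definition wy :: "nat pword" where "wy = Pow (Gen 1) 3"
definition wz :: "nat pword" where "wz = Pow (Gen 1) (int q)"

definition rel_order :: "nat pword" where
  "rel_order = Mul (Pow (Gen 0) (int p)) (Pow (Gen 1) (- int (3 * q)))"
definition rel_affine :: "nat pword" where
  "rel_affine = Mul (conj_word wy (Pow (Gen 0) (int (t + 1)))) (Pow (Gen 0) (- int t))"
definition rel_carmichael :: "nat pword" where
  "rel_carmichael = Pow (Mul wz (conj_word (Gen 0) wz)) 2"
definition rel_kill :: "nat pword" where
  "rel_kill = Pow (Mul wy (Mul (conj_word (Gen 0) wz) (conj_word (Pow (Gen 0) (- 1)) wz))) (int (q + 1))"

definition rels :: "nat pword set" where "rels = {rel_order, rel_affine, rel_carmichael}"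

lemmas rel_defs = rel_order_def rel_affine_def rel_carmichael_def rel_kill_def wy_def wz_def

lemma set_rels: "w \<in> insert rel_kill rels \<Longrightarrow> set_pword w \<subseteq> {0, 1}"
  by (auto simp: rels_def rel_defs set_conj_word)

lemma finite_rels: "finite rels"
  by (simp add: rels_def)

lemma card_rels: "card rels = 3" "card (insert rel_kill rels) = 4"
proof -
  have "rel_order \<noteq> rel_affine" "rel_order \<noteq> rel_carmichael" "rel_affine \<noteq> rel_carmichael"
    "rel_kill \<noteq> rel_order" "rel_kill \<noteq> rel_affine" "rel_kill \<noteq> rel_carmichael"
    using q_gt_1 by (simp_all add: rel_defs conj_word_def)
  then show "card rels = 3" "card (insert rel_kill rels) = 4"
    by (simp_all add: rels_def card_insert_if)
qed

text \<open>Used twice: in \<open>D\<close> to check the relators, and in the presented group to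
  obtain the assumptions of \<open>affine_carmichael\<close>.\<close>

lemma rels_iff:
  fixes G (structure)
  assumes "group G" and f: "f 0 \<in> carrier G" "f 1 \<in> carrier G"
  defines "x \<equiv> f 0" and "g \<equiv> f 1"
  shows "pword_val G f rel_order = \<one> \<longleftrightarrow> x [^] p = g [^] (3 * q)"
    and "pword_val G f rel_affine = \<one> \<longleftrightarrow> conjugate G (g [^] (3::nat)) (x [^] (t + 1)) = x [^] t"
    and "pword_val G f rel_carmichael = (g [^] q \<otimes> conjugate G x (g [^] q)) [^] (2::nat)"
    and "pword_val G f rel_kill = (g [^] (3::nat) \<otimes>
      (conjugate G x (g [^] q) \<otimes> conjugate G (inv x) (g [^] q))) [^] (q + 1)"
proof -
  interpret group G by fact
  have c: "x \<in> carrier G" "g \<in> carrier G" using f by (simp_all add: x_def g_def)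
  have v: "pword_val G f (Gen 0) = x" "pword_val G f (Gen 1) = g"
    "pword_val G f wy = g [^] (3::nat)" "pword_val G f wz = g [^] q"
    by (simp_all only: wy_def wz_def pword_val.simps x_def g_def int_pow_numeral int_pow_int)
  have mul_inv: "a \<otimes> inv b = \<one> \<longleftrightarrow> a = b" if "a \<in> carrier G" "b \<in> carrier G" for a b
    using that by (metis inv_equality inv_inv inv_closed r_inv)
  show "pword_val G f rel_order = \<one> \<longleftrightarrow> x [^] p = g [^] (3 * q)"
    unfolding rel_order_def pword_val.simps(2,3) v int_pow_int int_pow_neg_int[OF c(2)]
    by (rule mul_inv) (simp_all only: c nat_pow_closed)
  have cy: "pword_val G f wy \<in> carrier G" by (simp only: v c nat_pow_closed)
  show "pword_val G f rel_affine = \<one> \<longleftrightarrow> conjugate G (g [^] (3::nat)) (x [^] (t + 1)) = x [^] t"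
    unfolding rel_affine_def pword_val.simps(2,3) pword_val_conj_word[OF cy] v int_pow_int
      int_pow_neg_int[OF c(1)]
    by (rule mul_inv) (simp_all only: c nat_pow_closed conjugate_closed)
  have cx: "pword_val G f (Gen 0) \<in> carrier G" by (simp only: v c)
  show "pword_val G f rel_carmichael = (g [^] q \<otimes> conjugate G x (g [^] q)) [^] (2::nat)"
    unfolding rel_carmichael_def pword_val.simps(2,3) pword_val_conj_word[OF cx] v int_pow_numeral ..
  have inv: "pword_val G f (Pow (Gen 0) (- 1)) = inv x"
    by (simp only: pword_val.simps(3) v int_pow_minus_one[OF c(1)])
  have ci: "pword_val G f (Pow (Gen 0) (- 1)) \<in> carrier G" by (simp only: inv c inv_closed)
  show "pword_val G f rel_kill = (g [^] (3::nat) \<otimes>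
      (conjugate G x (g [^] q) \<otimes> conjugate G (inv x) (g [^] q))) [^] (q + 1)"
    unfolding rel_kill_def pword_val.simps(2) pword_val.simps(3)[of G f _ "int (q + 1)"]
      pword_val_conj_word[OF cx] pword_val_conj_word[OF ci] v inv int_pow_int ..
qed

lemma bl_rels:
  defines "L \<equiv> log 2 (real p)"
  shows "bl rel_order + bl rel_affine + bl rel_carmichael \<le> 10 + 18 * L"
    and "bl rel_kill \<le> 7 + 8 * L" and "L \<ge> 1"
proof -
  show L: "L \<ge> 1" unfolding L_def using p_gt_2 by (subst le_log_iff) simp_all
  \<comment> \<open>All exponents are at most 3p in absolute value, and 3p is at most the square of
    \<open>p\<close>; so a power costs at most 2 log p.\<close>
  have "real p * 3 \<le> real p * real p" using p_gt_2 by (intro mult_left_mono) simp_all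
  then have p2: "3 * real p \<le> real p ^ 2" by (simp add: power2_eq_square)
  have P: "bl (Pow w n) \<le> bl w + 2 * L" if "\<bar>real_of_int n\<bar> \<le> 3 * real p" for w :: "nat pword" and n
  proof -
    have "bl (Pow w n) \<le> bl w + log 2 (real p ^ 2)"
      using that p2 p_pos by (intro bl_Pow_le) (simp_all add: one_le_power)
    then show ?thesis using p_pos by (simp add: L_def log_nat_power)
  qed
  have q: "real q \<le> real p" "real (3 * q) \<le> 3 * real p" "real (q + 1) \<le> 3 * real p" using p_eq by simp_all
  have t: "real t \<le> 3 * real p" "real (t + 1) \<le> 3 * real p" using t_less by simp_all
  have wy: "bl wy \<le> 1 + 2 * L" using P[of 3 "Gen 1"] p_gt_2 by (simp add: wy_def)
  have wz: "bl wz \<le> 1 + 2 * L" using P[of "int q" "Gen 1"] q unfolding wz_def by simp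
  have "bl rel_order \<le> 2 + 4 * L"
    using P[of "int p" "Gen 0"] P[of "- int (3 * q)" "Gen 1"] q
    unfolding rel_order_def bl.simps(2) by simp
  moreover have "bl rel_affine \<le> 4 + 8 * L"
    using P[of "int (t + 1)" "Gen 0"] P[of "- int t" "Gen 0"] t wy
    unfolding rel_affine_def bl.simps(2) bl_conj_word by simp
  moreover have "bl rel_carmichael \<le> bl (Mul wz (conj_word (Gen 0) wz)) + 2 * L"
    unfolding rel_carmichael_def using p_gt_2 by (intro P) simp
  then have "bl rel_carmichael \<le> 4 + 6 * L" using wz by (simp add: bl_conj_word)
  ultimately show "bl rel_order + bl rel_affine + bl rel_carmichael \<le> 10 + 18 * L" by simp
  have "bl rel_kill \<le> bl (Mul wy (Mul (conj_word (Gen 0) wz) (conj_word (Pow (Gen 0) (- 1)) wz))) + 2 * L"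
    unfolding rel_kill_def using q by (intro P) simp
  then show "bl rel_kill \<le> 7 + 8 * L" using wy wz by (simp add: bl_conj_word)
qed

text \<open>With the two generators, the four relators cost at most 19 + 26 L, and
  \<open>L \<ge> 1\<close> turns this into 45 L.\<close>

lemma presentation_bl_rels:
  "presentation_bl {0::nat, 1} rels \<le> 45 * log 2 (real p)"
  "presentation_bl {0::nat, 1} (insert rel_kill rels) \<le> 45 * log 2 (real p)"
proof -
  have d: "rel_order \<notin> {rel_affine, rel_carmichael}" "rel_affine \<notin> {rel_carmichael}" "rel_kill \<notin> rels"
    using q_gt_1 by (simp_all add: rels_def rel_defs conj_word_def)
  have "sum bl rels = bl rel_order + bl rel_affine + bl rel_carmichael"
    unfolding rels_def using d by simp
  moreover have "sum bl (insert rel_kill rels) = bl rel_kill + sum bl rels"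
    using d finite_rels by simp
  ultimately show "presentation_bl {0::nat, 1} rels \<le> 45 * log 2 (real p)"
    "presentation_bl {0::nat, 1} (insert rel_kill rels) \<le> 45 * log 2 (real p)"
    using bl_rels by (simp_all add: presentation_bl_def)
qed

section \<open>Identification of the presented groups\<close>

definition gen :: "nat \<Rightarrow> (nat \<Rightarrow> nat) \<times> (int \<Rightarrow> int)" where
  "gen i = (if i = 0 then gx else gg)"

lemma presentation_data_rels: "presentation_data D gen {0, 1} rels"
proof
  have g: "gen 0 = gx" "gen 1 = gg" by (simp_all add: gen_def)
  then have gc: "gen 0 \<in> carrier D" "gen 1 \<in> carrier D" using gx_closed gg_closed by simp_all
  show "gen ` {0, 1} \<subseteq> carrier D" using gc by blast
  show "generate D (gen ` {0, 1}) = carrier D" using D_generated by (simp only: image_insert image_empty g)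
  show "pword_val D gen w = \<one>\<^bsub>D\<^esub>" if "w \<in> rels" for w
  proof -
    have "pword_val D gen rel_order = \<one>\<^bsub>D\<^esub>"
      unfolding rels_iff(1)[OF D.is_group gc] g by (rule D_rel1)
    moreover have "pword_val D gen rel_affine = \<one>\<^bsub>D\<^esub>"
      unfolding rels_iff(2)[OF D.is_group gc] g by (rule D_rel2)
    moreover have "pword_val D gen rel_carmichael = \<one>\<^bsub>D\<^esub>"
      unfolding rels_iff(3)[OF D.is_group gc] g by (rule D_rel3)
    ultimately show ?thesis using that unfolding rels_def by blast
  qed
  show "set_pword w \<subseteq> {0, 1}" if "w \<in> rels" for w using set_rels that by blast
qed (simp_all only: finite_rels finite.intros)

lemma affine_carmichael_presented:
  "affine_carmichael (presented_group {0, 1} rels)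
     (relators {0, 1} rels #>\<^bsub>free_group {0, 1}\<^esub> free_gen 0)
     (relators {0, 1} rels #>\<^bsub>free_group {0, 1}\<^esub> free_gen 1) p q m r t"
proof -
  let ?P = "presented_group {0, 1} rels"
  let ?f = "\<lambda>i. relators {0, 1} rels #>\<^bsub>free_group {0, 1}\<^esub> free_gen i"
  have words: "set_pword w \<subseteq> {0, 1}" if "w \<in> rels" for w using set_rels that by blast
  have P: "group ?P" using words by (intro group_presented_group) blast
  have gen: "generate ?P {?f 0, ?f 1} = carrier ?P"
    using presented_group_generated[of rels "{0, 1}", OF words] by (simp only: image_insert image_empty)
  have c: "?f i \<in> carrier ?P" if "i \<in> {0, 1}" for i
    unfolding presented_group_eq FactGroup_def RCOSETS_def using that by auto
  have holds: "pword_val ?P ?f w = \<one>\<^bsub>?P\<^esub>" if "w \<in> rels" for w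
    using presented_group_pword_val[OF words that] .
  show ?thesis
  proof (intro affine_carmichael.intro affine_carmichael_axioms.intro)
    show "?f 0 \<in> carrier ?P" "?f 1 \<in> carrier ?P" by (rule c; simp)+
  qed (use P gen p_pos q_pos q3 t_cong pm_r_pow_diff holds rels_iff[of ?P ?f, OF P c c] in \<open>simp_all add: rels_def\<close>)
qed

text \<open>The presented group maps onto \<open>D\<close>, and Carmichael's enumeration bounds its
  order by that of \<open>D\<close>.\<close>

lemma kernel_le_relators: "kernel (free_group {0, 1}) D (free_lift D gen) \<subseteq> relators {0, 1} rels"
proof (rule presentation_data.kernel_le_if_card_le[OF presentation_data_rels])
  note ac = affine_carmichael_presented
  show "finite (carrier (presented_group {0, 1} rels))" by (rule affine_carmichael.finite_carrier[OF ac])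
  show "card (carrier (presented_group {0, 1} rels)) \<le> card (carrier D)"
    using affine_carmichael.card_carrier_le[OF ac] unfolding card_D[symmetric] by simp
qed

lemma is_presentation_D: "is_presentation D {0, 1} rels"
  by (rule presentation_data.is_presentation_if_kernel_le[OF presentation_data_rels kernel_le_relators])

lemma is_presentation_A: "is_presentation A {0, 1} (insert rel_kill rels)"
proof (rule is_presentation_DirProd_fst[OF alt_group_is_group group_T presentation_data_rels kernel_le_relators])
  have g: "gen 0 = gx" "gen 1 = gg" by (simp_all add: gen_def)
  have gc: "gen 0 \<in> carrier D" "gen 1 \<in> carrier D" unfolding g by (rule gx_closed gg_closed)+
  show "pword_val D gen rel_kill = (\<one>\<^bsub>A\<^esub>, eta)"
    unfolding rels_iff(4)[OF D.is_group gc] unfolding g by (rule D_rel4)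
qed (use set_rels normal_closure_eta in auto)

end

text \<open>For p = 12k + 11 the number q = 6k + 5 is odd, and q + 1 is three times 2k + 2.\<close>

lemma ex_prime_11_mod_12:
  assumes "prime p" "[p = 11] (mod 12)"
  obtains q m h where "prime_11_mod_12 p q m h"
proof -
  obtain h where h: "residue_primroot p h" using prime_primitive_root_exists[of p] assms(1) prime_gt_1_nat by blast
  define k where "k = p div 12"
  have "p = 12 * k + 11" using assms(2) unfolding k_def cong_def by presburger
  then have "prime_11_mod_12 p (6 * k + 5) (2 * k + 2) h"
    using assms(1) h by unfold_locales simp_all
  then show ?thesis by (rule that)
qed

theorem corollary3p8:
  shows "(\<exists>C::real. \<forall>p::nat. prime p \<and> [p = 11] (mod 12) \<longrightarrow>
            (\<exists>(X::nat set) R. card X = 2 \<and> card R = 3 \<and>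
               is_presentation (alt_group (p + 2) \<times>\<times> AGL1_sq (residue_ring (int p))) X R \<and>
               presentation_bl X R \<le> C * log 2 (real p)))
       \<and> (\<exists>C::real. \<forall>p::nat. prime p \<and> [p = 11] (mod 12) \<longrightarrow>
            (\<exists>(X::nat set) R. card X = 2 \<and> card R = 4 \<and>
               is_presentation (alt_group (p + 2)) X R \<and>
               presentation_bl X R \<le> C * log 2 (real p)))"
proof (intro conjI exI[of _ 45] allI impI)
  fix p :: nat assume p: "prime p \<and> [p = 11] (mod 12)"
  then obtain q m h where "prime_11_mod_12 p q m h" using ex_prime_11_mod_12 by blast
  then interpret prime_11_mod_12 p q m h .
  have X: "card {0::nat, 1} = 2" by simp
  show "\<exists>(X::nat set) R. card X = 2 \<and> card R = 3 \<and>
      is_presentation (alt_group (p + 2) \<times>\<times> AGL1_sq (residue_ring (int p))) X R \<and>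
      presentation_bl X R \<le> 45 * log 2 (real p)"
    using X card_rels(1) is_presentation_D presentation_bl_rels(1) by blast
  show "\<exists>(X::nat set) R. card X = 2 \<and> card R = 4 \<and>
      is_presentation (alt_group (p + 2)) X R \<and> presentation_bl X R \<le> 45 * log 2 (real p)"
    using X card_rels(2) is_presentation_A presentation_bl_rels(2) by blast
qed

end
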